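(* Besides the multipliers $\alpha(0)$ and $\alpha(1)$, the Fibonacci-Dyck shift $F$ has no exceptional multipliers; that is, if $\mu$ is a multiplier with $\mu\notin\{\alpha(0),\alpha(1)\}$, then there is no $n\in\mathbb N$ such that $\mu$ is exceptional at period $n$.
   Context: The Dyck inverse monoid $\mathcal D_2$ is the monoid with zero generated by $\alpha_-(0),\alpha_-(1),\alpha_+(0),\alpha_+(1)$ with relations $\alpha_-(n)\alpha_+(m)=\mathbf 1$ if $n=m$ and $=0$ if $n\ne m$. Let $\mathcal D_2^-$ (resp. $\mathcal D_2^+$) be the free semigroup (without identity) generated in $\mathcal D_2$ by $\alpha_-(0),\alpha_-(1)$ (resp. $\alpha_+(0),\alpha_+(1)$). Fibonacci-Dyck shift $F$: consider the directed graph with vertices $0,1$ and six edges: $\beta^-(0)$ and $\beta^+(0)$ are loops at vertex $0$; $\beta^-$ goes from $0$ to $1$; $\beta^-(1)$ goes from $1$ to $0$; $\beta^+$ goes from $1$ to $0$; $\beta^+(1)$ goes from $0$ to $1$. Label the edges by $\lambda(\beta^-(i))=\alpha_-(i)$, $\lambda(\beta^+(i))=\alpha_+(i)$ for $i=0,1$, and $\lambda(\beta^-)=\lambda(\beta^+)=\mathbf 1$, and for a directed path $b=(b_1,\dots,b_I)$ set $\lambda(b)=\lambda(b_1)\cdots\lambda(b_I)\in\mathcal D_2$. $F$ is the subshift over the six-letter alphabet of edges whose admissible words are exactly the finite directed paths $b$ with $\lambda(b)\neq 0$. Multipliers: a word in the symbols $\alpha(0),\alpha(1)$ is primitive if it is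 nonempty and not a proper power of another word; a multiplier is an equivalence class of primitive words under cyclic permutation, denoted by any representative. Let $p\in F$ be periodic with smallest period $\Pi(p)$ (the length of its orbit), and write $p_{[i,i+\Pi(p))}=(p_i,\dots,p_{i+\Pi(p)-1})$. The point $p$ and its orbit have negative (resp. positive) multiplier if $\lambda(p_{[i,i+\Pi(p))})\in\mathcal D_2^-$ (resp. $\in\mathcal D_2^+$) for some $i\in\mathbb Z$. For a multiplier $\mu$, they have negative multiplier $\mu_-$ if there are $i\in\mathbb Z$, a representative $\alpha(n_1)\cdots\alpha(n_J)$ of $\mu$ and $\kappa\in\mathbb N$ ($\kappa\geq1$) with $\lambda(p_{[i,i+\Pi(p))})=(\alpha_-(n_1)\cdots\alpha_-(n_J))^\kappa$; they have positive multiplier $\mu_+$ if there are such data with $\lambda(p_{[i,i+\Pi(p))})=(\alpha_+(n_J)\cdots\alpha_+(n_1))^\kappa$. For $n\in\mathbb N$ let $\mathcal O_n^-$, $\mathcal O_n^+$, $\mathcal O_n(\mu_-)$, $\mathcal O_n(\mu_+)$ be the sets of periodic orbits of $F$ of length $n$ with, respectively, negative multiplier, positive multiplier, multiplier $\mu_-$, multiplier $\mu_+$. A multiplier $\mu$ is exceptional at period $n$ if $\operatorname{card}(\mathcal O_n(\mu_-)\cup\mathcal O_n(\mu_+))>\max\{\operatorname{card}(\mathcal O_n^-),\operatorname{card}(\mathcal O_n^+)\}$; it is exceptional if it is exceptional at some period $n\in\mathbb N$. *)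

theory Defs
  imports Main
begin

datatype idx = I0 | I1

datatype gen = Am idx | Ap idx

text \<open>Raw elements form the free monoid with zero on the generators: \<^term>\<open>Some w\<close> is a word,
  \<^term>\<open>None\<close> is the zero.\<close>

fun raw_mult :: "gen list option \<Rightarrow> gen list option \<Rightarrow> gen list option" where
  "raw_mult (Some u) (Some v) = Some (u @ v)"
| "raw_mult None _ = None"
| "raw_mult _ None = None"

lemma raw_mult_None_right [simp]: "raw_mult x None = None"
  by (cases x) auto

lemma raw_mult_assoc: "raw_mult (raw_mult x y) z = raw_mult x (raw_mult y z)"
  by (cases x; cases y; cases z) auto

text \<open>The congruence generated by the defining relations.\<close>

inductive dyck_cong :: "gen list option \<Rightarrow> gen list option \<Rightarrow> bool" where
  cancel: "dyck_cong (Some [Am n, Ap n]) (Some [])"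
| annihilate: "n \<noteq> m \<Longrightarrow> dyck_cong (Some [Am n, Ap m]) None"
| refl: "dyck_cong x x"
| sym: "dyck_cong x y \<Longrightarrow> dyck_cong y x"
| trans: "dyck_cong x y \<Longrightarrow> dyck_cong y z \<Longrightarrow> dyck_cong x z"
| mult: "dyck_cong x x' \<Longrightarrow> dyck_cong y y' \<Longrightarrow> dyck_cong (raw_mult x y) (raw_mult x' y')"

quotient_type dyck = "gen list option" / dyck_cong
proof (rule equivpI)
  show "reflp dyck_cong" by (auto intro: reflpI dyck_cong.refl)
  show "symp dyck_cong" by (auto intro: sympI dyck_cong.sym)
  show "transp dyck_cong" by (blast intro: transpI dyck_cong.trans)
qed

instantiation dyck :: "{monoid_mult, mult_zero}"
begin

lift_definition zero_dyck :: dyck is None .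
lift_definition one_dyck :: dyck is "Some []" .
lift_definition times_dyck :: "dyck \<Rightarrow> dyck \<Rightarrow> dyck" is raw_mult
  by (rule dyck_cong.mult)

instance
proof
  fix a b c :: dyck
  show "a * b * c = a * (b * c)"
    by transfer (simp add: raw_mult_assoc dyck_cong.refl)
  show "1 * a = a"
  proof transfer
    fix x show "dyck_cong (raw_mult (Some []) x) x"
      by (cases x) (auto intro: dyck_cong.refl)
  qed
  show "a * 1 = a"
  proof transfer
    fix x show "dyck_cong (raw_mult x (Some [])) x"
      by (cases x) (auto intro: dyck_cong.refl)
  qed
  show "0 * a = 0" by transfer (simp add: dyck_cong.refl)
  show "a * 0 = 0" by transfer (simp add: dyck_cong.refl)
qed

end

lift_definition alpha_minus :: "idx \<Rightarrow> dyck" is "\<lambda>n. Some [Am n]" .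
lift_definition alpha_plus :: "idx \<Rightarrow> dyck" is "\<lambda>n. Some [Ap n]" .

lemma alpha_minus_alpha_plus:
  "alpha_minus n * alpha_plus m = (if n = m then 1 else 0)"
  by transfer (auto intro: dyck_cong.cancel dyck_cong.annihilate)

text \<open>The presented monoid is nontrivial: the generators act on stacks by partial injections
  (\<^term>\<open>Ap n\<close> pushes \<^term>\<open>n\<close>, \<^term>\<open>Am n\<close> pops it), and the zero acts as the empty map.\<close>

fun gen_act :: "gen \<Rightarrow> idx list \<Rightarrow> idx list option" where
  "gen_act (Ap n) s = Some (n # s)"
| "gen_act (Am n) [] = None"
| "gen_act (Am n) (k # s) = (if k = n then Some s else None)"

fun raw_act :: "gen list option \<Rightarrow> idx list \<Rightarrow> idx list option" where
  "raw_act None s = None"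
| "raw_act (Some w) s = foldr (\<lambda>g r. Option.bind r (gen_act g)) w (Some s)"

lemma foldr_bind_None: "foldr (\<lambda>g r. Option.bind r (gen_act g)) w None = None"
  by (induction w) auto

lemma raw_act_mult: "raw_act (raw_mult x y) = (\<lambda>s. Option.bind (raw_act y s) (raw_act x))"
proof
  fix s
  show "raw_act (raw_mult x y) s = Option.bind (raw_act y s) (raw_act x)"
  proof (cases "x = None \<or> y = None")
    case True
    have "Option.bind r (raw_act None) = None" for r
      by (cases r) auto
    with True show ?thesis by auto
  next
    case False
    then obtain u v where "x = Some u" "y = Some v" by auto
    then show ?thesis
      by (cases "foldr (\<lambda>g r. Option.bind r (gen_act g)) v (Some s)")
        (auto simp: foldr_bind_None)
  qed
qed

lemma raw_act_cong: "dyck_cong x y \<Longrightarrow> raw_act x = raw_act y"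
proof (induction rule: dyck_cong.induct)
  case (mult x x' y y')
  then show ?case by (simp add: raw_act_mult)
qed (auto simp: fun_eq_iff)

instance dyck :: zero_neq_one
proof
  show "(0::dyck) \<noteq> 1"
  proof transfer
    show "\<not> dyck_cong None (Some [])"
    proof
      assume "dyck_cong None (Some [])"
      from fun_cong[OF raw_act_cong[OF this], of "[]"] show False by simp
    qed
  qed
qed

inductive_set semigroup_gen :: "'a::semigroup_mult set \<Rightarrow> 'a set" for A where
  base: "a \<in> A \<Longrightarrow> a \<in> semigroup_gen A"
| mult: "a \<in> semigroup_gen A \<Longrightarrow> b \<in> semigroup_gen A \<Longrightarrow> a * b \<in> semigroup_gen A"

definition dyck_minus :: "dyck set" where
  "dyck_minus = semigroup_gen (range alpha_minus)"

definition dyck_plus :: "dyck set" where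
  "dyck_plus = semigroup_gen (range alpha_plus)"

datatype vertex = V0 | V1

text \<open>\<^term>\<open>Bm i\<close>, \<^term>\<open>Bp i\<close> are the indexed edges \<open>\<beta>\<^sup>-(i)\<close>, \<open>\<beta>\<^sup>+(i)\<close>;
  \<^term>\<open>Em\<close>, \<^term>\<open>Ep\<close> are the unindexed edges \<open>\<beta>\<^sup>-\<close>, \<open>\<beta>\<^sup>+\<close>.\<close>

datatype edge = Bm idx | Bp idx | Em | Ep

fun src :: "edge \<Rightarrow> vertex" where
  "src (Bm I0) = V0"
| "src (Bp I0) = V0"
| "src Em = V0"
| "src (Bm I1) = V1"
| "src Ep = V1"
| "src (Bp I1) = V0"

fun tgt :: "edge \<Rightarrow> vertex" where
  "tgt (Bm I0) = V0"
| "tgt (Bp I0) = V0"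
| "tgt Em = V1"
| "tgt (Bm I1) = V0"
| "tgt Ep = V0"
| "tgt (Bp I1) = V1"

fun edge_label :: "edge \<Rightarrow> dyck" where
  "edge_label (Bm i) = alpha_minus i"
| "edge_label (Bp i) = alpha_plus i"
| "edge_label Em = 1"
| "edge_label Ep = 1"

definition path_label :: "edge list \<Rightarrow> dyck" where
  "path_label b = prod_list (map edge_label b)"

definition directed_path :: "edge list \<Rightarrow> bool" where
  "directed_path b \<longleftrightarrow> successively (\<lambda>e e'. tgt e = src e') b"

definition block :: "(int \<Rightarrow> 'a) \<Rightarrow> int \<Rightarrow> nat \<Rightarrow> 'a list" where
  "block p i n = map (\<lambda>k. p (i + int k)) [0..<n]"

definition fib_dyck :: "(int \<Rightarrow> edge) set" where
  "fib_dyck = {p. \<forall>i n. directed_path (block p i n) \<and> path_label (block p i n) \<noteq> 0}"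

text \<open>The language of \<^term>\<open>fib_dyck\<close> is the prescribed set of words: every directed path with
  nonzero label extends to a point, on the left by edges labelled by \<^const>\<open>alpha_plus\<close> and on
  the right by edges labelled by \<^const>\<open>alpha_minus\<close>.\<close>

lemma length_block [simp]: "length (block p i n) = n"
  by (simp add: block_def)

lemma nth_block [simp]: "k < n \<Longrightarrow> block p i n ! k = p (i + int k)"
  by (simp add: block_def)

lemma block_add: "block p i (m + n) = block p i m @ block p (i + int m) n"
  by (rule nth_equalityI) (auto simp: nth_append algebra_simps of_nat_diff)

lemma path_label_append: "path_label (u @ v) = path_label u * path_label v"
  by (simp add: path_label_def)

lemma alpha_plus_mult_nonzero: "x \<noteq> 0 \<Longrightarrow> alpha_plus n * x \<noteq> 0"
  using mult.assoc[of "alpha_minus n" "alpha_plus n" x] by (auto simp: alpha_minus_alpha_plus)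

lemma mult_alpha_minus_nonzero: "x \<noteq> 0 \<Longrightarrow> x * alpha_minus n \<noteq> 0"
  using mult.assoc[of x "alpha_minus n" "alpha_plus n"] by (auto simp: alpha_minus_alpha_plus)

lemma fib_dyck_extend:
  assumes b: "b \<noteq> []" "directed_path b" "path_label b \<noteq> 0"
  shows "\<exists>p\<in>fib_dyck. block p 0 (length b) = b"
proof -
  define N where "N = length b"
  have N: "N > 0" using b by (simp add: N_def)
  define l where "l = (\<lambda>i::int. if i = -1 \<and> src (hd b) = V1 then Bp I1 else Bp I0)"
  define r where "r = (\<lambda>i::int. if i = int N \<and> tgt (last b) = V1 then Bm I1 else Bm I0)"
  define p where "p = (\<lambda>i. if i < 0 then l i else if i < int N then b ! nat i else r i)"
  have blk: "block p 0 N = b"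
    by (rule nth_equalityI) (auto simp: N_def p_def)
  have step: "tgt (p i) = src (p (i + 1))" for i
  proof -
    consider "i < -1" | "i = -1" | "0 \<le> i" "i + 1 < int N" | "i + 1 = int N" | "i \<ge> int N"
      by linarith
    then show ?thesis
    proof cases
      case 1
      then show ?thesis by (auto simp: p_def l_def)
    next
      case 2
      then show ?thesis
        using N b(1) by (cases "src (hd b)") (auto simp: p_def l_def hd_conv_nth)
    next
      case 3
      then have "Suc (nat i) < length b" "nat (i + 1) = Suc (nat i)"
        by (auto simp: N_def)
      then show ?thesis
        using b(2) 3 by (auto simp: p_def directed_path_def successively_conv_nth)
    next
      case 4
      have "b ! nat i = last b"
      proof -
        have "nat i = length b - 1" using 4 by (simp add: N_def)
        then show ?thesis using b(1) by (simp add: last_conv_nth)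
      qed
      then show ?thesis
        using 4 N by (cases "tgt (last b)") (auto simp: p_def r_def)
    next
      case 5
      then show ?thesis by (auto simp: p_def r_def)
    qed
  qed
  have left: "path_label (block p (- int m) (m + N)) \<noteq> 0" for m
  proof (induction m)
    case 0
    then show ?case using b blk by simp
  next
    case (Suc m)
    have "\<exists>n. edge_label (p (- int (Suc m))) = alpha_plus n"
      by (auto simp: p_def l_def)
    moreover have "block p (- int (Suc m)) (Suc m + N)
        = [p (- int (Suc m))] @ block p (- int m) (m + N)"
      using block_add[of p "- int (Suc m)" 1 "m + N"] by (simp add: block_def)
    ultimately show ?case
      using alpha_plus_mult_nonzero[OF Suc] by (auto simp: path_label_def)
  qed
  have both: "path_label (block p (- int m) (m + N + k)) \<noteq> 0" for m k
  proof (induction k)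
    case 0
    then show ?case using left by simp
  next
    case (Suc k)
    have "\<exists>n. edge_label (p (int (N + k))) = alpha_minus n"
      by (auto simp: p_def r_def)
    moreover have "block p (- int m) (m + N + Suc k)
        = block p (- int m) (m + N + k) @ [p (int (N + k))]"
      using block_add[of p "- int m" "m + N + k" 1] by (simp add: block_def)
    ultimately show ?case
      using mult_alpha_minus_nonzero[OF Suc] by (auto simp: path_label_def)
  qed
  have "path_label (block p i n) \<noteq> 0" for i n
  proof
    assume z: "path_label (block p i n) = 0"
    define m where "m = nat \<bar>i\<bar>"
    define a where "a = nat (i + int m)"
    have a: "- int m + int a = i" unfolding a_def m_def by linarith
    have "block p (- int m) (m + N + (a + n))
        = block p (- int m) (a + (n + (m + N)))"
      by (simp add: algebra_simps)
    also have "\<dots> = block p (- int m) a @ block p i n @ block p (i + int n) (m + N)"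
      by (simp only: block_add a)
    finally show False using both[of m "a + n"] z by (simp add: path_label_append)
  qed
  moreover have "directed_path (block p i n)" for i n
    using step by (auto simp: directed_path_def successively_conv_nth algebra_simps)
  ultimately have "p \<in> fib_dyck" by (simp add: fib_dyck_def)
  with blk show ?thesis by (auto simp: N_def)
qed

lemma fib_dyck_language:
  "{b. \<exists>p\<in>fib_dyck. \<exists>i n. b = block p i n} = {b. directed_path b \<and> path_label b \<noteq> 0}"
proof (intro equalityI subsetI; clarify)
  fix b assume b: "directed_path b" "path_label b \<noteq> 0"
  show "\<exists>p\<in>fib_dyck. \<exists>i n. b = block p i n"
  proof (cases "b = []")
    case True
    have "path_label [Bm I0] \<noteq> 0"
      using mult_alpha_minus_nonzero[of 1 I0] by (simp add: path_label_def)
    then obtain p where "p \<in> fib_dyck"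
      using fib_dyck_extend[of "[Bm I0]"] by (auto simp: directed_path_def)
    moreover have "b = block p 0 0" using True by (simp add: block_def)
    ultimately show ?thesis by blast
  next
    case False
    from fib_dyck_extend[OF False b] show ?thesis by metis
  qed
qed (auto simp: fib_dyck_def)

definition shift :: "(int \<Rightarrow> 'a) \<Rightarrow> int \<Rightarrow> 'a" where
  "shift p = (\<lambda>i. p (i + 1))"

definition periodic :: "(int \<Rightarrow> 'a) \<Rightarrow> bool" where
  "periodic p \<longleftrightarrow> (\<exists>n>0. (shift ^^ n) p = p)"

definition least_period :: "(int \<Rightarrow> 'a) \<Rightarrow> nat" where
  "least_period p = (LEAST n. n > 0 \<and> (shift ^^ n) p = p)"

definition shift_orbit :: "(int \<Rightarrow> 'a) \<Rightarrow> (int \<Rightarrow> 'a) set" where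
  "shift_orbit p = range (\<lambda>k::int. \<lambda>i. p (i + k))"

text \<open>A word \<open>\<alpha>(n\<^sub>1)\<dots>\<alpha>(n\<^sub>J)\<close> is represented by its index list.\<close>

definition primitive :: "'a list \<Rightarrow> bool" where
  "primitive w \<longleftrightarrow> w \<noteq> [] \<and> \<not> (\<exists>u k. k \<ge> 2 \<and> w = concat (replicate k u))"

definition cyclic_class :: "'a list \<Rightarrow> 'a list set" where
  "cyclic_class w = range (\<lambda>k. rotate k w)"

definition multipliers :: "idx list set set" where
  "multipliers = cyclic_class ` {w. primitive w}"

definition has_negative_multiplier :: "(int \<Rightarrow> edge) \<Rightarrow> bool" where
  "has_negative_multiplier p \<longleftrightarrow> (\<exists>i. path_label (block p i (least_period p)) \<in> dyck_minus)"

definition has_positive_multiplier :: "(int \<Rightarrow> edge) \<Rightarrow> bool" where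
  "has_positive_multiplier p \<longleftrightarrow> (\<exists>i. path_label (block p i (least_period p)) \<in> dyck_plus)"

definition has_multiplier_minus :: "idx list set \<Rightarrow> (int \<Rightarrow> edge) \<Rightarrow> bool" where
  "has_multiplier_minus \<mu> p \<longleftrightarrow>
    (\<exists>i. \<exists>w\<in>\<mu>. \<exists>\<kappa>\<ge>1.
      path_label (block p i (least_period p)) = prod_list (map alpha_minus w) ^ \<kappa>)"

definition has_multiplier_plus :: "idx list set \<Rightarrow> (int \<Rightarrow> edge) \<Rightarrow> bool" where
  "has_multiplier_plus \<mu> p \<longleftrightarrow>
    (\<exists>i. \<exists>w\<in>\<mu>. \<exists>\<kappa>\<ge>1.
      path_label (block p i (least_period p)) = prod_list (map alpha_plus (rev w)) ^ \<kappa>)"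

text \<open>Each of the four properties is shift-invariant, because of the quantifier over the position
  \<open>i\<close>, so it does not matter which point of the orbit is inspected.\<close>

definition orbits_with :: "((int \<Rightarrow> edge) \<Rightarrow> bool) \<Rightarrow> nat \<Rightarrow> (int \<Rightarrow> edge) set set" where
  "orbits_with P n = shift_orbit ` {p \<in> fib_dyck. periodic p \<and> least_period p = n \<and> P p}"

definition orbits_minus :: "nat \<Rightarrow> (int \<Rightarrow> edge) set set" where
  "orbits_minus = orbits_with has_negative_multiplier"

definition orbits_plus :: "nat \<Rightarrow> (int \<Rightarrow> edge) set set" where
  "orbits_plus = orbits_with has_positive_multiplier"

definition orbits_mult_minus :: "nat \<Rightarrow> idx list set \<Rightarrow> (int \<Rightarrow> edge) set set" where
  "orbits_mult_minus n \<mu> = orbits_with (has_multiplier_minus \<mu>) n"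

definition orbits_mult_plus :: "nat \<Rightarrow> idx list set \<Rightarrow> (int \<Rightarrow> edge) set set" where
  "orbits_mult_plus n \<mu> = orbits_with (has_multiplier_plus \<mu>) n"

definition exceptional_at :: "idx list set \<Rightarrow> nat \<Rightarrow> bool" where
  "exceptional_at \<mu> n \<longleftrightarrow>
    card (orbits_mult_minus n \<mu> \<union> orbits_mult_plus n \<mu>)
      > max (card (orbits_minus n)) (card (orbits_plus n))"

definition exceptional :: "idx list set \<Rightarrow> bool" where
  "exceptional \<mu> \<longleftrightarrow> (\<exists>n\<ge>1. exceptional_at \<mu> n)"

end

theory Submission
  imports Defs
begin

text \<open>Reading a word from left to right, each edge \<open>\<beta>\<^sup>-(i)\<close> opens a bracket of type \<open>i\<close> and each
\<open>\<beta>\<^sup>+(i)\<close> closes one; the label is a product of generators \<open>\<alpha>\<^sub>-\<close> exactly if every closing bracket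
matches an opening one of its own type, and then the unmatched opening brackets spell the label. Reversing time and exchanging
the two kinds of edges is a symmetry of \<open>F\<close> that takes multiplier \<open>\<mu>\<^sub>+\<close> to \<open>\<mu>\<^sub>-\<close>
(\<open>card_orbits_mult_plus_le\<close>), so it suffices to show
\<open>2 card O\<^sub>n(\<mu>\<^sub>-) \<le> card O\<^sub>n\<^sup>-\<close>, and for this to map the orbits with multiplier \<open>\<mu>\<^sub>-\<close> injectively to
orbits with a negative multiplier other than \<open>\<mu>\<close> (\<open>card_orbits_mult_minus\<close>).

The source of other multipliers is the following move. Let \<open>U\<close> be a closed path at vertex 0 with label
\<open>1\<close> that never sits at vertex 1 with all its brackets closed. In a factor \<open>\<beta>\<^sup>-(1) U \<beta>\<^sup>-(0)\<close> whose
two outer edges are unmatched, the edge \<open>\<beta>\<^sup>-(1)\<close> may be replaced by \<open>\<beta>\<^sup>+\<close>: both lead from vertex 1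
to vertex 0, so the length and the path property survive, but one letter \<open>\<alpha>(1)\<close> disappears from the
multiplier. Cut a cyclic word after every unmatched \<open>\<beta>\<^sup>-(0)\<close>. Each block then either admits no such
move, or is \<open>D x U \<beta>\<^sup>-(0)\<close> with a unique \<open>D\<close>, a unique \<open>U\<close> and a binary choice of
\<open>x \<in> {\<beta>\<^sup>-(1), \<beta>\<^sup>+}\<close> (\<open>body_exists\<close>, \<open>body_inject\<close>); in the latter case it is called a site, and it is
folded if \<open>x = \<beta>\<^sup>+\<close>. Keeping the cyclic sequence of all \<open>(D, U)\<close> fixed and changing the number of
folded sites changes the number of letters \<open>\<alpha>(1)\<close> but not that of letters \<open>\<alpha>(0)\<close>, whereas
for a given number of letters \<open>\<alpha>(0)\<close> only one number of letters \<open>\<alpha>(1)\<close> is compatible with \<open>\<mu>\<close>.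

Since \<open>\<mu>\<close> is neither \<open>\<alpha>(0)\<close> nor \<open>\<alpha>(1)\<close>, it has a representative that begins with \<open>\<alpha>(1)\<close> and ends
with \<open>\<alpha>(0)\<close>. Reading an orbit with multiplier \<open>\<mu>\<close> so that it spells a power of this representative
distinguishes one block, which is a site because it contains an unmatched \<open>\<beta>\<^sup>-(1)\<close>. The sequence of
\<open>(D, U)\<close> read from there determines the orbit, because the letters tell which sites are folded. Hence
the image must only remember this sequence together with its starting point: fold that site only;
or, if exactly one site was folded, fold all sites but that one. This fails only if exactly one of
exactly two sites was folded, as then both sites are candidates for the starting point. In this
case the images are the word without folds and the word with both folds, assigned to the two starting
points in an arbitrary but fixed way. If the two starting points cannot be told apart, the sequence
is a square \<open>y y\<close>, and the remaining image is an orbit with multiplier \<open>\<alpha>(1)\<close>: the word spelled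
by \<open>y\<close> without its last edge, followed by its own time reversal and by \<open>\<beta>\<^sup>- \<beta>\<^sup>-(1)\<close> (\<open>doubled\<close>).\<close>

section \<open>Labels and unmatched edges\<close>

text \<open>Acting on stacks separates the elements of \<open>\<D>\<^sub>2\<close> that matter here: a product of generators
\<open>\<alpha>\<^sub>-\<close> can be read off from the shortest stack on which it is defined.\<close>

lift_definition stack_act :: "dyck \<Rightarrow> idx list \<Rightarrow> idx list option" is raw_act
  by (rule raw_act_cong)

lemma stack_act_zero: "stack_act 0 s = None"
  by transfer simp

lemma stack_act_one: "stack_act 1 s = Some s"
  by transfer simp

lemma stack_act_mult: "stack_act (x * y) s = Option.bind (stack_act y s) (stack_act x)"
  by transfer (simp add: raw_act_mult)

lemma stack_act_alpha_minus: "stack_act (alpha_minus n) (k # s) = (if k = n then Some s else None)"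
  by transfer simp

lemma stack_act_alpha_minus_Nil: "stack_act (alpha_minus n) [] = None"
  by transfer simp

lemma stack_act_alpha_plus: "stack_act (alpha_plus n) s = Some (n # s)"
  by transfer simp

abbreviation minus_word :: "idx list \<Rightarrow> dyck" where
  "minus_word ms \<equiv> prod_list (map alpha_minus ms)"

lemma stack_act_minus_word: "stack_act (minus_word ms) (rev ms @ s) = Some s"
proof (induction ms arbitrary: s)
  case (Cons m ms)
  show ?case
    using Cons[of "m # s"] by (simp add: stack_act_mult stack_act_alpha_minus)
qed (simp add: stack_act_one)

lemma minus_word_nonzero: "minus_word ms \<noteq> 0"
  using stack_act_minus_word[of ms "[]"] by (auto simp: stack_act_zero)

lemma stack_act_minus_wordD:
  "stack_act (minus_word ms) s = Some t \<Longrightarrow> s = rev ms @ t"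
proof (induction ms arbitrary: t)
  case (Cons m ms)
  from Cons.prems obtain u where u: "stack_act (minus_word ms) s = Some u"
    "stack_act (alpha_minus m) u = Some t"
    by (auto simp: stack_act_mult bind_eq_Some_conv)
  from u(2) have "u = m # t"
    by (cases u) (auto simp: stack_act_alpha_minus stack_act_alpha_minus_Nil split: if_splits)
  with Cons.IH[OF u(1)] show ?case by simp
qed (simp add: stack_act_one)

lemma minus_word_inject:
  assumes "minus_word ms = minus_word ms'" shows "ms = ms'"
  using stack_act_minus_word[of ms "[]"] stack_act_minus_wordD[of ms' "rev ms" "[]"] assms by simp

text \<open>A stack machine that recognises the labels in \<open>\<D>\<^sub>2\<^sup>-\<close>: the stack holds the types of the brackets
that are still open, the innermost one on top. Failure means that the label, multiplied from the left
by the word of the initial stack, is \<open>0\<close> or has a factor \<open>\<alpha>\<^sub>+\<close> in its normal form.\<close>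

fun run :: "idx list \<Rightarrow> edge list \<Rightarrow> idx list option" where
  "run s [] = Some s"
| "run s (Bm i # b) = run (i # s) b"
| "run s (Bp i # b) = (case s of [] \<Rightarrow> None | j # s' \<Rightarrow> if i = j then run s' b else None)"
| "run s (Em # b) = run s b"
| "run s (Ep # b) = run s b"

lemma path_label_Cons: "path_label (e # b) = edge_label e * path_label b"
  by (simp add: path_label_def)

lemma run_imp_label:
  "run s b = Some t \<Longrightarrow> minus_word (rev s) * path_label b = minus_word (rev t)"
proof (induction s b arbitrary: t rule: run.induct)
  case (1 s)
  then show ?case by (simp add: path_label_def)
next
  case (2 s i b)
  then show ?case by (simp add: path_label_Cons mult.assoc)
next
  case (3 s i b)
  then obtain s' where s: "s = i # s'" "run s' b = Some t"
    by (auto split: list.splits if_splits)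
  have "alpha_minus i * (alpha_plus i * path_label b) = path_label b"
    by (simp add: alpha_minus_alpha_plus flip: mult.assoc)
  with 3 s show ?case by (simp add: path_label_Cons mult.assoc)
qed (simp_all add: path_label_Cons)

text \<open>A closing bracket that meets the empty stack, or an open bracket of the other type, can never
be repaired further to the right: a product beginning with \<open>\<alpha>\<^sub>+(i)\<close> leaves \<open>i\<close> on top of the stack it acts on,
whereas a product of generators \<open>\<alpha>\<^sub>-\<close> can empty a stack.\<close>

lemma label_imp_run:
  "minus_word (rev s) * path_label b = minus_word ms \<Longrightarrow> run s b = Some (rev ms)"
proof (induction s b rule: run.induct)
  case (1 s)
  then show ?case by (auto simp: path_label_def dest: minus_word_inject)
next
  case (2 s i b)
  then show ?case by (simp add: path_label_Cons mult.assoc)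
next
  case (3 s i b)
  have "s \<noteq> []"
  proof
    assume "s = []"
    then have "alpha_plus i * path_label b = minus_word ms" using 3 by (simp add: path_label_Cons)
    then have "stack_act (alpha_plus i * path_label b) (rev ms) = Some []"
      using stack_act_minus_word[of ms "[]"] by simp
    then show False by (auto simp: stack_act_mult stack_act_alpha_plus bind_eq_Some_conv)
  qed
  then obtain j s' where s: "s = j # s'" by (cases s) auto
  have m: "alpha_minus j * (alpha_plus i * path_label b) = (if j = i then path_label b else 0)"
    by (simp add: alpha_minus_alpha_plus flip: mult.assoc)
  have "j = i" using 3(2) s m minus_word_nonzero[of ms]
    by (auto simp: path_label_Cons mult.assoc split: if_splits)
  with 3 s m show ?case by (simp add: path_label_Cons mult.assoc)
qed (simp_all add: path_label_Cons)

lemma label_eq_minus_word_iff: "path_label b = minus_word ms \<longleftrightarrow> run [] b = Some (rev ms)"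
  using run_imp_label[of "[]" b "rev ms"] label_imp_run[of "[]" b ms] by auto

lemma run_append: "run s (a @ b) = Option.bind (run s a) (\<lambda>t. run t b)"
  by (induction s a rule: run.induct) (auto split: list.splits)

lemma run_frame: "run s b = Some t \<Longrightarrow> run (s @ r) b = Some (t @ r)"
  by (induction s b rule: run.induct) (auto split: list.splits if_splits)

lemma run_frame_Nil: "run [] b = Some t \<Longrightarrow> run r b = Some (t @ r)"
  using run_frame[of "[]" b t r] by simp

lemma run_prefix: "run s (a @ b) = Some t \<Longrightarrow> \<exists>u. run s a = Some u \<and> run u b = Some t"
  by (auto simp: run_append bind_eq_Some_conv)

text \<open>The innermost open bracket was opened at some edge, and everything after that edge is balanced.
The induction on the length is needed because a closing last edge hides two open brackets.\<close>

lemma run_top: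
  "run [] b = Some (m # s) \<Longrightarrow>
    \<exists>c N. b = c @ Bm m # N \<and> run [] c = Some s \<and> run [] N = Some []"
proof (induction "length b" arbitrary: b m s rule: less_induct)
  case less
  from less.prems have "b \<noteq> []" by auto
  then obtain b' e where b: "b = b' @ [e]" by (metis rev_exhaust)
  from less.prems b obtain u where u: "run [] b' = Some u" "run u [e] = Some (m # s)"
    using run_prefix by blast
  show ?case
  proof (cases e)
    case (Bm i)
    with u b show ?thesis by (intro exI[of _ b'] exI[of _ "[]"]) auto
  next
    case (Bp i)
    with u have "u = i # m # s" by (auto split: list.splits if_splits)
    with u less.hyps[of b' i "m # s"] b obtain c1 N1 where
      1: "b' = c1 @ Bm i # N1" "run [] c1 = Some (m # s)" "run [] N1 = Some []" by auto
    from less.hyps[of c1 m s] 1 b obtain c N where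
      2: "c1 = c @ Bm m # N" "run [] c = Some s" "run [] N = Some []" by auto
    have "run [] (N @ Bm i # N1 @ [Bp i]) = Some []"
      using 1 2 by (simp add: run_append run_frame_Nil)
    with 1 2 b Bp show ?thesis
      by (intro exI[of _ c] exI[of _ "N @ Bm i # N1 @ [Bp i]"]) auto
  next
    case Em
    with u less.hyps[of b' m s] b obtain c N where
      "b' = c @ Bm m # N" "run [] c = Some s" "run [] N = Some []" by auto
    with b Em show ?thesis
      by (intro exI[of _ c] exI[of _ "N @ [Em]"]) (auto simp: run_append)
  next
    case Ep
    with u less.hyps[of b' m s] b obtain c N where
      "b' = c @ Bm m # N" "run [] c = Some s" "run [] N = Some []" by auto
    with b Ep show ?thesis
      by (intro exI[of _ c] exI[of _ "N @ [Ep]"]) (auto simp: run_append)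
  qed
qed

lemma run_split:
  "run [] b = Some (r @ m # s) \<Longrightarrow>
    \<exists>c N. b = c @ Bm m # N \<and> run [] c = Some s \<and> run [] N = Some r"
proof (induction r arbitrary: b)
  case Nil
  then show ?case using run_top by simp
next
  case (Cons a r)
  from run_top[of b a "r @ m # s"] Cons.prems obtain c1 N1 where
    1: "b = c1 @ Bm a # N1" "run [] c1 = Some (r @ m # s)" "run [] N1 = Some []" by auto
  from Cons.IH[OF 1(2)] obtain c N where
    2: "c1 = c @ Bm m # N" "run [] c = Some s" "run [] N = Some r" by blast
  have "run [] (N @ Bm a # N1) = Some (a # r)" using 1 2 by (simp add: run_append run_frame_Nil)
  with 1 2 show ?case by (intro exI[of _ c] exI[of _ "N @ Bm a # N1"]) auto
qed

section \<open>Cutting a block at its last crossing\<close>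

fun walk :: "vertex \<Rightarrow> edge list \<Rightarrow> vertex \<Rightarrow> bool" where
  "walk u [] v \<longleftrightarrow> u = v"
| "walk u (e # b) v \<longleftrightarrow> src e = u \<and> walk (tgt e) b v"

lemma walk_append: "walk u (a @ b) v \<longleftrightarrow> (\<exists>x. walk u a x \<and> walk x b v)"
  by (induction a arbitrary: u) auto

lemma walk_append_Cons: "walk u (a @ e # b) v \<longleftrightarrow> walk u a (src e) \<and> walk (tgt e) b v"
  by (auto simp: walk_append)

lemma tgt_Bm [simp]: "tgt (Bm i) = V0"
  by (cases i) auto

text \<open>Balanced closed paths at vertex 0 that visit vertex 1 only inside some bracket. They are the
paths after the last return to vertex 0 on the outermost level.\<close>

definition pure :: "edge list \<Rightarrow> bool" where
  "pure U \<longleftrightarrow> walk V0 U V0 \<and> run [] U = Some [] \<and>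
    (\<forall>a c. U = a @ c \<longrightarrow> run [] a = Some [] \<longrightarrow> \<not> walk V0 a V1)"

lemma pure_Nil [simp]: "pure []"
  by (simp add: pure_def)

lemma pure_extend:
  assumes U: "pure U" and N: "run [] N = Some []" "walk V0 N V0"
  shows "pure (U @ Bm I0 # N @ [Bp I0])"
  unfolding pure_def
proof (intro conjI allI impI notI)
  show "walk V0 (U @ Bm I0 # N @ [Bp I0]) V0"
    using U N by (auto simp: pure_def walk_append_Cons walk_append)
  show "run [] (U @ Bm I0 # N @ [Bp I0]) = Some []"
    using U N by (simp add: pure_def run_append run_frame_Nil)
  fix a c
  assume ac: "U @ Bm I0 # N @ [Bp I0] = a @ c" "run [] a = Some []" "walk V0 a V1"
  from ac(1) consider r where "U = a @ r" | n where "N @ [Bp I0] = n @ c" "a = U @ Bm I0 # n"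
    by (auto simp: append_eq_append_conv2 Cons_eq_append_conv)
  then show False
  proof cases
    case 1
    with U ac show False by (auto simp: pure_def)
  next
    case 2
    have Ur: "run [] U = Some []" using U by (simp add: pure_def)
    show False
    proof (cases c rule: rev_cases)
      case Nil
      with 2 have "a = U @ Bm I0 # N @ [Bp I0]" by simp
      with ac(3) show False by (auto simp: walk_append_Cons walk_append)
    next
      case (snoc c' z)
      with 2 have "N = n @ c'" by simp
      then obtain t where "run [] n = Some t" using N run_prefix by blast
      with Ur ac(2) 2 show False by (auto simp: run_append run_frame_Nil)
    qed
  qed
qed

text \<open>Look at the last edge. It is either \<open>\<beta>\<^sup>+\<close>, which is then the last return to vertex 0, or it closes
a bracket of type \<open>0\<close> opened at vertex 0, which can be removed before recursing to the left.\<close>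

lemma neutral_cut:
  "walk V0 b V0 \<Longrightarrow> run [] b = Some [] \<Longrightarrow>
    pure b \<or> (\<exists>a U. b = a @ Ep # U \<and> run [] a = Some [] \<and> walk V0 a V1 \<and> pure U)"
proof (induction "length b" arbitrary: b rule: less_induct)
  case less
  show ?case
  proof (cases b rule: rev_cases)
    case Nil
    then show ?thesis by simp
  next
    case (snoc b' e)
    from less.prems snoc obtain u where u: "run [] b' = Some u" "run u [e] = Some []"
      using run_prefix by blast
    have w: "walk V0 b' (src e)" "tgt e = V0" using less.prems snoc by (auto simp: walk_append_Cons)
    show ?thesis
    proof (cases e)
      case (Bm i)
      with u show ?thesis by simp
    next
      case Em
      with w show ?thesis by simp
    next
      case Ep
      with u w snoc show ?thesis by (intro disjI2 exI[of _ b'] exI[of _ "[]"]) auto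
    next
      case (Bp i)
      with w have i: "i = I0" by (cases i) auto
      with u Bp have "run [] b' = Some [I0]" by (auto split: list.splits if_splits)
      from run_top[OF this] obtain c N where
        c: "b' = c @ Bm I0 # N" "run [] c = Some []" "run [] N = Some []" by auto
      have wc: "walk V0 c V0" "walk V0 N V0" using w c Bp i by (auto simp: walk_append_Cons)
      have b: "b = c @ Bm I0 # N @ [Bp I0]" using snoc c Bp i by simp
      from less.hyps[of c] c wc b consider "pure c"
        | a U where "c = a @ Ep # U" "run [] a = Some []" "walk V0 a V1" "pure U" by auto
      then show ?thesis
      proof cases
        case 1
        with b pure_extend[OF 1 c(3) wc(2)] show ?thesis by simp
      next
        case 2
        with b pure_extend[OF 2(4) c(3) wc(2)] show ?thesis
          by (intro disjI2 exI[of _ a] exI[of _ "U @ Bm I0 # N @ [Bp I0]"]) auto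
      qed
    qed
  qed
qed

text \<open>The pair \<open>(D, U)\<close> stands for the part of a block before the unmatched \<open>\<beta>\<^sup>-(0)\<close> with the edge \<open>x\<close> between
\<open>D\<close> and \<open>U\<close> forgotten; the Boolean restores it. Blocks that never return from vertex 1 on the
outermost level are encoded by \<open>D = []\<close>, which is unambiguous because a path from vertex 0 to vertex 1 is not
empty; for them the Boolean is normalised to \<^term>\<open>False\<close>.\<close>

type_synonym core = "edge list \<times> edge list"

fun body :: "core \<times> bool \<Rightarrow> edge list" where
  "body ((D, U), f) = (if D = [] then U else D @ (if f then Ep else Bm I1) # U)"

definition site :: "core \<Rightarrow> bool" where
  "site u \<longleftrightarrow> fst u \<noteq> []"

fun valid :: "core \<times> bool \<Rightarrow> bool" where
  "valid ((D, U), f) \<longleftrightarrow> pure U \<and>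
    (if D = [] then \<not> f else walk V0 D V1 \<and> (\<exists>j. run [] D = Some (replicate j I1)))"

fun ones :: "core \<times> bool \<Rightarrow> nat" where
  "ones ((D, U), f) =
    (if D = [] then 0 else length (the (run [] D)) + (if f then 0 else 1))"

lemma walk_body: "valid x \<Longrightarrow> walk V0 (body x) V0"
  by (cases x rule: valid.cases) (auto simp: pure_def walk_append_Cons split: if_splits)

lemma run_body: "valid x \<Longrightarrow> run [] (body x) = Some (replicate (ones x) I1)"
  by (cases x rule: valid.cases)
    (auto simp: pure_def run_append run_frame_Nil split: if_splits)

text \<open>The last unmatched \<open>\<beta>\<^sup>-(1)\<close> is a return to vertex 0; a later balanced return by \<open>\<beta>\<^sup>+\<close> takes
precedence over it.\<close>

lemma body_exists:
  assumes "walk V0 b V0" "run [] b = Some (replicate j I1)"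
  shows "\<exists>x. valid x \<and> body x = b"
proof (cases j)
  case 0
  with assms have "run [] b = Some []" by simp
  from neutral_cut[OF assms(1) this] consider "pure b"
    | a U where "b = a @ Ep # U" "run [] a = Some []" "walk V0 a V1" "pure U" by auto
  then show ?thesis
  proof cases
    case 1
    then show ?thesis by (intro exI[of _ "(([], b), False)"]) auto
  next
    case 2
    then show ?thesis by (intro exI[of _ "((a, U), True)"]) (auto intro: exI[of _ 0])
  qed
next
  case (Suc k)
  with assms have "run [] b = Some (I1 # replicate k I1)" by simp
  from run_top[OF this] obtain c N where
    c: "b = c @ Bm I1 # N" "run [] c = Some (replicate k I1)" "run [] N = Some []" by auto
  with assms have w: "walk V0 c V1" "walk V0 N V0" by (auto simp: walk_append_Cons)
  from neutral_cut[OF w(2) c(3)] consider "pure N"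
    | a U where "N = a @ Ep # U" "run [] a = Some []" "walk V0 a V1" "pure U" by auto
  then show ?thesis
  proof cases
    case 1
    with c w show ?thesis by (intro exI[of _ "((c, N), False)"]) auto
  next
    case 2
    have "run [] (c @ Bm I1 # a) = Some (replicate (Suc k) I1)"
      using c 2 by (simp add: run_append run_frame_Nil)
    \<comment> \<open>The unmatched \<open>\<beta>\<^sup>-(1)\<close> is now part of \<open>D\<close>, and the later return by \<open>\<beta>\<^sup>+\<close> is the fold.\<close>
    then have "\<exists>j. run [] (c @ Bm I1 # a) = Some (replicate j I1)" by blast
    with 2 c w show ?thesis
      by (intro exI[of _ "((c @ Bm I1 # a, U), True)"]) (auto simp: walk_append_Cons simp del: run.simps)
  qed
qed

text \<open>This is what makes the cut unique: an outermost return to vertex 0 inside \<open>U\<close> would be preceded by a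
balanced path to vertex 1, and an opening \<open>\<beta>\<^sup>-(1)\<close> there could not be closed by the balanced rest.\<close>

lemma pure_no_crossing:
  assumes "pure U" "U = a @ x # c" "walk V0 a V1" "x = Ep \<or> x = Bm I1" "run [] c = Some []"
  shows False
proof -
  have U: "run [] (a @ x # c) = Some []" using assms by (simp add: pure_def)
  then obtain t where t: "run [] a = Some t" "run t (x # c) = Some []" using run_prefix by blast
  with assms(4,5) have "t = []" "x = Ep" by (auto simp: run_frame_Nil)
  with assms t show False by (auto simp: pure_def)
qed

lemma body_cut_le:
  assumes "D @ x # U = D' @ x' # U'" "length D \<le> length D'" "pure U" "pure U'"
    "walk V0 D V1" "walk V0 D' V1" "x \<in> {Ep, Bm I1}" "x' \<in> {Ep, Bm I1}"
  shows "D = D' \<and> x = x' \<and> U = U'"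
proof -
  from assms(1,2) obtain a where a: "D' = D @ a" "x # U = a @ x' # U'"
    by (auto simp: append_eq_append_conv2)
  show ?thesis
  proof (cases a)
    case Nil
    with a show ?thesis by simp
  next
    case (Cons y a')
    with a have U: "U = a' @ x' # U'" "D' = D @ x # a'" by auto
    have "walk V0 a' V1" using assms(6,7) U by (auto simp: walk_append_Cons)
    with pure_no_crossing[OF assms(3) U(1)] assms(4,8) show ?thesis by (auto simp: pure_def)
  qed
qed

lemma body_inject:
  assumes "valid x" "valid y" "body x = body y"
  shows "x = y"
proof -
  obtain D U f where x: "x = ((D, U), f)" by (metis surj_pair)
  obtain D' U' f' where y: "y = ((D', U'), f')" by (metis surj_pair)
  have n: False if "pure U1" "U1 = D2 @ (if g then Ep else Bm I1) # U2" "walk V0 D2 V1" "pure U2"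
    for U1 D2 U2 g
    using pure_no_crossing[OF that(1,2,3)] that(4) by (cases g) (auto simp: pure_def)
  consider "D = []" "D' = []" | "D = []" "D' \<noteq> []" | "D \<noteq> []" "D' = []" | "D \<noteq> []" "D' \<noteq> []"
    by blast
  then show ?thesis
  proof cases
    case 1
    with assms x y show ?thesis by auto
  next
    case 2
    then have "U = D' @ (if f' then Ep else Bm I1) # U'"
      using assms(3) unfolding x y by simp
    moreover have "pure U" "pure U'" "walk V0 D' V1" using assms(1,2) 2 unfolding x y by simp_all
    ultimately show ?thesis using n[of U D' f' U'] by blast
  next
    case 3
    then have "U' = D @ (if f then Ep else Bm I1) # U"
      using assms(3) unfolding x y by simp
    moreover have "pure U" "pure U'" "walk V0 D V1" using assms(1,2) 3 unfolding x y by simp_all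
    ultimately show ?thesis using n[of U' D f U] by blast
  next
    case 4
    have *: "D = D' \<and> (if f then Ep else Bm I1) = (if f' then Ep else Bm I1) \<and> U = U'"
    proof (cases "length D \<le> length D'")
      case True
      show ?thesis
        by (rule body_cut_le) (use assms x y 4 True in auto)
    next
      case False
      have "D' = D \<and> (if f' then Ep else Bm I1) = (if f then Ep else Bm I1) \<and> U' = U"
        by (rule body_cut_le) (use assms x y 4 False in auto)
      then show ?thesis by auto
    qed
    then show ?thesis using x y by (auto split: if_splits)
  qed
qed

section \<open>Conjugate words\<close>

definition conjugate :: "'a list \<Rightarrow> 'a list \<Rightarrow> bool" where
  "conjugate b c \<longleftrightarrow> (\<exists>p q. b = p @ q \<and> c = q @ p)"

text \<open>For nonempty words this is primitivity, in the form in which a least period uses it: no proper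
rotation fixes the word.\<close>

definition aperiodic :: "'a list \<Rightarrow> bool" where
  "aperiodic b \<longleftrightarrow> (\<forall>p q. b = p @ q \<longrightarrow> b = q @ p \<longrightarrow> p = [] \<or> q = [])"

lemma conjugate_sym: "conjugate b c \<Longrightarrow> conjugate c b"
  by (auto simp: conjugate_def)

lemma conjugate_refl: "conjugate b b"
  by (auto simp: conjugate_def intro: exI[of _ "[]"])

lemma conjugate_length_filter: "conjugate b c \<Longrightarrow> length (filter P b) = length (filter P c)"
  by (auto simp: conjugate_def)

lemma conjugate_length: "conjugate b c \<Longrightarrow> length b = length c"
  by (auto simp: conjugate_def)

lemma conjugate_count: "conjugate b c \<Longrightarrow> count_list b x = count_list c x"
  by (auto simp: conjugate_def)

lemma conjugate_map: "conjugate b c \<Longrightarrow> conjugate (map f b) (map f c)"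
  unfolding conjugate_def by (metis map_append)

text \<open>A property that holds for just one entry marks the starting point of a cyclic word.\<close>

lemma unique_head_conjugate:
  assumes "b = p @ q" "c = q @ p" "b \<noteq> []" "P (hd b)" "P (hd c)" "length (filter P b) = 1"
  shows "p = [] \<or> q = []"
proof (rule ccontr)
  assume "\<not> ?thesis"
  then obtain x p' y q' where pq: "p = x # p'" "q = y # q'" by (auto simp: neq_Nil_conv)
  with assms show False by auto
qed

lemma unique_head_aperiodic:
  assumes "b \<noteq> []" "P (hd b)" "length (filter P b) = 1"
  shows "aperiodic b"
  unfolding aperiodic_def using unique_head_conjugate[OF _ _ assms(1,2) _ assms(3)] assms(2) by metis

lemma unique_head_conjugate_eq:
  assumes "conjugate b c" "b \<noteq> []" "P (hd b)" "P (hd c)" "length (filter P b) = 1"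
  shows "b = c"
  using assms unique_head_conjugate[where P = P] unfolding conjugate_def
  by (metis append.right_neutral append_Nil)

text \<open>The number of unmatched \<open>\<beta>\<^sup>-(m)\<close> in a word with a negative label, written so that invariance under
rotation is evident.\<close>

definition weight :: "idx \<Rightarrow> edge list \<Rightarrow> int" where
  "weight m b = int (count_list b (Bm m)) - int (count_list b (Bp m))"

lemma weight_conjugate: "conjugate b c \<Longrightarrow> weight m b = weight m c"
  by (simp add: weight_def conjugate_count)

lemma run_weight:
  "run s b = Some t \<Longrightarrow> int (count_list t m) = int (count_list s m) + weight m b"
  by (induction s b rule: run.induct) (auto simp: weight_def split: list.splits if_splits)

section \<open>Sequences of blocks\<close>

definition spell :: "(core \<times> bool) list \<Rightarrow> edge list" where
  "spell xs = concat (map (\<lambda>x. body x @ [Bm I0]) xs)"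

lemma spell_simps [simp]:
  "spell [] = []" "spell (x # xs) = body x @ Bm I0 # spell xs" "spell (xs @ ys) = spell xs @ spell ys"
  by (simp_all add: spell_def)

abbreviation letters :: "(core \<times> bool) list \<Rightarrow> idx list" where
  "letters xs \<equiv> concat (map (\<lambda>x. replicate (ones x) I1 @ [I0]) xs)"

abbreviation valids :: "(core \<times> bool) list \<Rightarrow> bool" where
  "valids xs \<equiv> (\<forall>x\<in>set xs. valid x)"

lemma walk_spell: "valids xs \<Longrightarrow> walk V0 (spell xs) V0"
  by (induction xs) (auto simp: walk_append_Cons walk_body)

lemma run_spell: "valids xs \<Longrightarrow> run [] (spell xs) = Some (rev (letters xs))"
  by (induction xs) (simp_all add: run_append run_body run_frame_Nil)

text \<open>Cut at the last open bracket of type \<open>0\<close>; what precedes it has fewer edges, and what follows it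
has open brackets of type \<open>1\<close> only.\<close>

lemma spell_exists:
  "walk V0 b u \<Longrightarrow> run [] b = Some s \<Longrightarrow>
    \<exists>xs c j. valids xs \<and> b = spell xs @ c \<and> run [] c = Some (replicate j I1) \<and> walk V0 c u"
proof (induction "length b" arbitrary: b u s rule: less_induct)
  case less
  show ?case
  proof (cases "I0 \<in> set s")
    case False
    then have "s = replicate (length s) I1"
      by (intro replicate_eqI) (auto, metis idx.exhaust)
    with less.prems show ?thesis
      by (intro exI[of _ "[]"] exI[of _ b] exI[of _ "length s"]) auto
  next
    case True
    then obtain r s' where s: "s = r @ I0 # s'" "I0 \<notin> set r" by (metis split_list_first)
    have r: "r = replicate (length r) I1"
      using s(2) by (intro replicate_eqI) (auto, metis idx.exhaust)
    from run_split less.prems(2) s obtain c N where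
      c: "b = c @ Bm I0 # N" "run [] c = Some s'" "run [] N = Some r" by blast
    with less.prems have w: "walk V0 c V0" "walk V0 N u" by (auto simp: walk_append_Cons)
    from less.hyps[OF _ w(1) c(2)] c(1) obtain xs c' j where
      xs: "valids xs" "c = spell xs @ c'" "run [] c' = Some (replicate j I1)" "walk V0 c' V0" by auto
    from body_exists[OF xs(4,3)] obtain x where "valid x" "body x = c'" by blast
    with xs c w r show ?thesis
      by (intro exI[of _ "xs @ [x]"] exI[of _ N] exI[of _ "length r"]) auto
  qed
qed

lemma spell_exists_closed:
  assumes "walk V0 b V0" "run [] b = Some s"
  shows "\<exists>xs. valids xs \<and> xs \<noteq> [] \<and> b @ [Bm I0] = spell xs"
proof -
  from spell_exists[OF assms] obtain xs c j where
    xs: "valids xs" "b = spell xs @ c" "run [] c = Some (replicate j I1)" "walk V0 c V0" by blast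
  from body_exists[OF xs(4,3)] obtain x where "valid x" "body x = c" by blast
  with xs show ?thesis by (intro exI[of _ "xs @ [x]"]) auto
qed

lemma run_prefix_defined: "run s (a @ b) \<noteq> None \<Longrightarrow> run s a \<noteq> None"
  by (cases "run s a") (simp_all add: run_append)

text \<open>Within a block every bracket of type \<open>0\<close> is closed, so an edge \<open>\<beta>\<^sup>-(0)\<close> there cannot be followed by
a word that never needs to close it.\<close>

lemma no_open_I0:
  assumes "run [] (a @ Bm I0 # c) = Some (replicate j I1)" "run [] c \<noteq> None"
  shows False
proof -
  obtain t where "run [] c = Some t" using assms by blast
  moreover obtain u where "run [] a = Some u" using assms(1) run_prefix by blast
  ultimately have "replicate j I1 = t @ I0 # u" using assms(1) by (simp add: run_append run_frame_Nil)
  then have "I0 \<in> set (replicate j I1)" by simp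
  then show False by (auto split: if_splits)
qed

lemma append_Cons_eq_cases:
  assumes "a @ x # b = c @ y # d"
  obtains "a = c" "b = d" | r where "a = c @ y # r" "d = r @ x # b"
    | r where "c = a @ x # r" "b = r @ y # d"
proof -
  from assms obtain us where "a = c @ us \<and> us @ x # b = y # d \<or> a @ us = c \<and> x # b = us @ y # d"
    unfolding append_eq_append_conv2 by blast
  then show thesis using that by (cases us) auto
qed

text \<open>An edge \<open>\<beta>\<^sup>-(0)\<close> that the rest of the word does not close is the end of a block.\<close>

lemma spell_cut:
  "valids xs \<Longrightarrow> spell xs = u @ Bm I0 # v \<Longrightarrow> run [] v \<noteq> None \<Longrightarrow>
    \<exists>xs1 xs2. xs = xs1 @ xs2 \<and> spell xs1 = u @ [Bm I0] \<and> spell xs2 = v"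
proof (induction xs arbitrary: u)
  case (Cons x xs)
  then have e: "body x @ Bm I0 # spell xs = u @ Bm I0 # v" by simp
  have rx: "run [] (body x) = Some (replicate (ones x) I1)" using Cons.prems by (simp add: run_body)
  from e consider "body x = u" "spell xs = v"
    | a where "body x = u @ Bm I0 # a" "v = a @ Bm I0 # spell xs"
    | a where "u = body x @ Bm I0 # a" "spell xs = a @ Bm I0 # v"
    by (rule append_Cons_eq_cases)
  then show ?case
  proof cases
    case 1
    then show ?thesis by (intro exI[of _ "[x]"] exI[of _ xs]) auto
  next
    case 2
    then have "run [] a \<noteq> None" using Cons.prems(3) run_prefix_defined by simp
    then show ?thesis using no_open_I0 rx unfolding 2(1) by blast
  next
    case 3
    from Cons.IH[OF _ 3(2)] Cons.prems obtain xs1 xs2 where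
      "xs = xs1 @ xs2" "spell xs1 = a @ [Bm I0]" "spell xs2 = v" by auto
    with 3 show ?thesis by (intro exI[of _ "x # xs1"] exI[of _ xs2]) auto
  qed
qed simp

lemma spell_inject:
  "valids xs \<Longrightarrow> valids ys \<Longrightarrow> spell xs = spell ys \<Longrightarrow> xs = ys"
proof (induction xs arbitrary: ys)
  case Nil
  then show ?case by (cases ys) auto
next
  case (Cons x xs)
  then obtain y ys' where ys: "ys = y # ys'" by (cases ys) auto
  have rx: "run [] (body x) = Some (replicate (ones x) I1)"
    "run [] (body y) = Some (replicate (ones y) I1)" using Cons.prems ys by (simp_all add: run_body)
  have r: "run [] (spell xs) \<noteq> None" "run [] (spell ys') \<noteq> None" using Cons.prems ys by (simp_all add: run_spell)
  have "body x @ Bm I0 # spell xs = body y @ Bm I0 # spell ys'" using Cons.prems ys by simp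
  then consider "body x = body y" "spell xs = spell ys'"
    | a where "body x = body y @ Bm I0 # a" "spell ys' = a @ Bm I0 # spell xs"
    | a where "body y = body x @ Bm I0 # a" "spell xs = a @ Bm I0 # spell ys'"
    by (rule append_Cons_eq_cases)
  then show ?case
  proof cases
    case 1
    have "x = y" by (rule body_inject) (use Cons.prems ys 1 in auto)
    moreover have "xs = ys'" by (rule Cons.IH) (use Cons.prems ys 1 in auto)
    ultimately show ?thesis using ys by simp
  next
    case 2
    then have "run [] a \<noteq> None" using r(2) run_prefix_defined by simp
    then show ?thesis using no_open_I0 rx(1) unfolding 2(1) by blast
  next
    case 3
    then have "run [] a \<noteq> None" using r(1) run_prefix_defined by simp
    then show ?thesis using no_open_I0 rx(2) unfolding 3(1) by blast
  qed
qed

lemma last_spell: "xs \<noteq> [] \<Longrightarrow> \<exists>b. spell xs = b @ [Bm I0]"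
  by (cases xs rule: rev_cases) auto

text \<open>Rotating one spelled word into another moves only whole blocks, since the end of the second word is
an unmatched \<open>\<beta>\<^sup>-(0)\<close> of the first. So blocks may be treated as letters of cyclic words.\<close>

lemma spell_rotation:
  assumes "valids xs" "valids ys" "spell xs = u @ v" "spell ys = v @ u" "u \<noteq> []"
  shows "\<exists>xs1 xs2. xs = xs1 @ xs2 \<and> ys = xs2 @ xs1 \<and> spell xs1 = u \<and> spell xs2 = v"
proof -
  have "ys \<noteq> []" using assms by auto
  from last_spell[OF this] assms(4,5) obtain u' where u: "u = u' @ [Bm I0]"
    by (metis append_butlast_last_id last_appendR last_snoc)
  have "run [] (v @ u) \<noteq> None" using run_spell[OF assms(2)] assms(4) by simp
  then have "run [] v \<noteq> None" by (rule run_prefix_defined)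
  with spell_cut[OF assms(1), of u' v] assms(3) u obtain xs1 xs2 where
    x: "xs = xs1 @ xs2" "spell xs1 = u" "spell xs2 = v" by auto
  have "ys = xs2 @ xs1" by (rule spell_inject) (use assms x in auto)
  with x show ?thesis by blast
qed

lemma spell_conjugate:
  assumes "valids xs" "valids ys" "conjugate (spell xs) (spell ys)"
  shows "conjugate xs ys"
proof -
  from assms(3) obtain u v where uv: "spell xs = u @ v" "spell ys = v @ u" by (auto simp: conjugate_def)
  show ?thesis
  proof (cases "u = []")
    case True
    with uv spell_inject[OF assms(1,2)] show ?thesis by (simp add: conjugate_refl)
  next
    case False
    from spell_rotation[OF assms(1,2) uv False] show ?thesis by (auto simp: conjugate_def)
  qed
qed

lemma spell_aperiodic:
  assumes "valids xs" "aperiodic xs"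
  shows "aperiodic (spell xs)"
  unfolding aperiodic_def
proof (intro allI impI)
  fix p q assume pq: "spell xs = p @ q" "spell xs = q @ p"
  show "p = [] \<or> q = []"
  proof (cases "p = []")
    case False
    from spell_rotation[OF assms(1,1) pq False] obtain xs1 xs2 where
      "xs = xs1 @ xs2" "xs = xs2 @ xs1" "spell xs1 = p" "spell xs2 = q" by blast
    with assms(2) show ?thesis unfolding aperiodic_def by (metis spell_simps(1))
  qed simp
qed

lemma length_body: "valid x \<Longrightarrow> valid y \<Longrightarrow> fst x = fst y \<Longrightarrow> length (body x) = length (body y)"
  by (cases x rule: body.cases; cases y rule: body.cases) auto

lemma length_spell:
  "valids xs \<Longrightarrow> valids ys \<Longrightarrow> map fst xs = map fst ys \<Longrightarrow> length (spell xs) = length (spell ys)"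
proof (induction xs arbitrary: ys)
  case (Cons x xs)
  then obtain y ys' where "ys = y # ys'" by (cases ys) auto
  with Cons length_body[of x y] show ?case by auto
qed simp

lemma replicate_I1_eq:
  "replicate i I1 @ I0 # a = replicate j I1 @ I0 # b \<Longrightarrow> i = j \<and> a = b"
proof (induction i arbitrary: j)
  case 0 then show ?case by (cases j) auto
next
  case (Suc i) then show ?case by (cases j) auto
qed

text \<open>The number of letters \<open>\<alpha>(1)\<close> in a block tells whether its site is folded.\<close>

lemma letters_inject:
  "valids xs \<Longrightarrow> valids ys \<Longrightarrow> map fst xs = map fst ys \<Longrightarrow> letters xs = letters ys \<Longrightarrow> xs = ys"
proof (induction xs arbitrary: ys)
  case (Cons x xs)
  then obtain y ys' where ys: "ys = y # ys'" by (cases ys) auto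
  have "replicate (ones x) I1 @ I0 # letters xs = replicate (ones y) I1 @ I0 # letters ys'"
    using Cons.prems(4) ys by simp
  then have o: "ones x = ones y" "letters xs = letters ys'"
    using replicate_I1_eq by blast+
  have "x = y" using o(1) Cons.prems ys
    by (cases x rule: ones.cases; cases y rule: ones.cases) (auto split: if_splits)
  moreover have "xs = ys'" by (rule Cons.IH) (use Cons.prems ys o in auto)
  ultimately show ?case using ys by simp
qed simp

abbreviation folds :: "(core \<times> bool) list \<Rightarrow> nat" where
  "folds xs \<equiv> length (filter snd xs)"

lemma count_letters_I0: "count_list (letters xs) I0 = length xs"
  by (induction xs) auto

text \<open>Each fold removes one letter \<open>\<alpha>(1)\<close> from a total that depends on the cores only.\<close>

lemma count_letters_I1:
  "valids xs \<Longrightarrow> count_list (letters xs) I1 + folds xs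
    = sum_list (map (\<lambda>u. ones (u, False)) (map fst xs))"
proof (induction xs)
  case (Cons x xs)
  have r: "count_list (replicate j I1) I1 = j" for j by (induction j) auto
  have "count_list (replicate (ones x) I1) I1 + (if snd x then 1 else 0) = ones (fst x, False)"
    using Cons.prems by (cases x rule: ones.cases) (auto simp: r)
  with Cons show ?case by (auto split: if_splits)
qed simp

section \<open>Changing the folded sites\<close>

definition sites :: "core list \<Rightarrow> nat" where
  "sites e = length (filter site e)"

definition all_free :: "core list \<Rightarrow> (core \<times> bool) list" where
  "all_free e = map (\<lambda>u. (u, False)) e"

definition all_folded :: "core list \<Rightarrow> (core \<times> bool) list" where
  "all_folded e = map (\<lambda>u. (u, site u)) e"

definition fold_head :: "core list \<Rightarrow> (core \<times> bool) list" where
  "fold_head e = (hd e, True) # all_free (tl e)"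

definition fold_tail :: "core list \<Rightarrow> (core \<times> bool) list" where
  "fold_tail e = (hd e, False) # all_folded (tl e)"

text \<open>For a sequence that begins with one of its two sites, the rotation that begins with the other one.\<close>

definition other :: "core list \<Rightarrow> core list" where
  "other e = dropWhile (\<lambda>u. \<not> site u) (tl e) @ hd e # takeWhile (\<lambda>u. \<not> site u) (tl e)"

text \<open>The choice between the last two cases depends only on the set of the two starting points, so
exactly one of them gets the word without folds.\<close>

definition refold :: "(core \<times> bool) list \<Rightarrow> (core \<times> bool) list" where
  "refold xs = (let e = map fst xs in
     if folds xs \<noteq> 1 then fold_head e
     else if sites e \<noteq> 2 then fold_tail e
     else if (SOME e'. e' \<in> {e, other e}) = e then all_free e
     else all_folded e)"

definition symmetric :: "(core \<times> bool) list \<Rightarrow> bool" where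
  "symmetric xs \<longleftrightarrow> (let e = map fst xs in folds xs = 1 \<and> sites e = 2 \<and> other e = e)"

lemma map_fst_free [simp]: "map fst (all_free e) = e"
  by (simp add: all_free_def comp_def)

lemma map_fst_folded [simp]: "map fst (all_folded e) = e"
  by (simp add: all_folded_def comp_def)

lemma map_fst_refold [simp]: "xs \<noteq> [] \<Longrightarrow> map fst (refold xs) = map fst xs"
  by (cases xs) (simp_all add: refold_def Let_def fold_head_def fold_tail_def)

lemma folds_free [simp]: "filter snd (all_free e) = []"
  by (induction e) (auto simp: all_free_def)

lemma folds_folded [simp]: "folds (all_folded e) = sites e"
  by (induction e) (auto simp: all_folded_def sites_def)

lemma valid_free: "valid x \<Longrightarrow> valid (fst x, False)"
  by (cases x rule: valid.cases) (auto split: if_splits)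

lemma valid_folded: "valid x \<Longrightarrow> valid (fst x, site (fst x))"
  by (cases x rule: valid.cases) (auto simp: site_def split: if_splits)

lemma valids_free: "valids xs \<Longrightarrow> set e \<subseteq> fst ` set xs \<Longrightarrow> valids (all_free e)"
proof
  fix z assume a: "valids xs" "set e \<subseteq> fst ` set xs" "z \<in> set (all_free e)"
  from a(3) obtain u where u: "u \<in> set e" "z = (u, False)" unfolding all_free_def by auto
  from u(1) a(2) obtain x where "x \<in> set xs" "u = fst x" by blast
  with valid_free[of x] a(1) u show "valid z" by blast
qed

lemma valids_folded: "valids xs \<Longrightarrow> set e \<subseteq> fst ` set xs \<Longrightarrow> valids (all_folded e)"
proof
  fix z assume a: "valids xs" "set e \<subseteq> fst ` set xs" "z \<in> set (all_folded e)"
  from a(3) obtain u where u: "u \<in> set e" "z = (u, site u)" unfolding all_folded_def by auto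
  from u(1) a(2) obtain x where "x \<in> set xs" "u = fst x" by blast
  with valid_folded[of x] a(1) u show "valid z" by blast
qed

lemma valids_refold:
  assumes "valids xs" "xs \<noteq> []" "site (fst (hd xs))"
  shows "valids (refold xs)"
proof -
  obtain x xs' where x: "xs = x # xs'" using assms by (cases xs) auto
  have "valids (all_free (map fst xs'))" "valids (all_folded (map fst xs'))"
    "valids (all_free (map fst xs))" "valids (all_folded (map fst xs))"
    by (rule valids_free[OF assms(1)] valids_folded[OF assms(1)]; use x in auto)+
  moreover have "valid (fst x, False)" "valid (fst x, True)"
    using valid_free[of x] valid_folded[of x] assms x by auto
  ultimately show ?thesis using x
    by (simp add: refold_def Let_def fold_head_def fold_tail_def)
qed

lemma other_eq:
  assumes "e = p @ q" "p \<noteq> []" "q \<noteq> []" "site (hd e)" "site (hd q)" "sites e = 2"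
  shows "other e = q @ p"
proof -
  obtain x p' y q' where pq: "p = x # p'" "q = y # q'" using assms by (auto simp: neq_Nil_conv)
  have "\<forall>u\<in>set p'. \<not> site u" using assms pq by (auto simp: sites_def filter_empty_conv)
  then show ?thesis using assms pq by (simp add: other_def)
qed

lemma sites_power: "sites (concat (replicate m z)) = m * sites z"
  by (induction m) (simp_all add: sites_def)

lemma other_cut:
  assumes "e \<noteq> []" "site (hd e)" "sites e = 2"
  obtains p q where "e = p @ q" "p \<noteq> []" "q \<noteq> []" "site (hd q)" "sites p = 1" "sites q = 1"
proof -
  obtain x e' where e: "e = x # e'" using assms by (cases e) auto
  define p where "p = takeWhile (\<lambda>u. \<not> site u) e'"
  define q where "q = dropWhile (\<lambda>u. \<not> site u) e'"
  have "\<forall>u\<in>set p. \<not> site u" unfolding p_def by (auto dest: set_takeWhileD)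
  then have sp: "sites (x # p) = 1" using assms e by (auto simp: sites_def filter_empty_conv)
  have "e = (x # p) @ q" using e by (simp add: p_def q_def)
  moreover from this have "sites e = sites (x # p) + sites q"
    unfolding sites_def by (metis filter_append length_append)
  with sp assms(3) have "sites q = 1" by simp
  moreover from this have "q \<noteq> []" by (auto simp: sites_def)
  moreover from this have "site (hd q)" unfolding q_def using hd_dropWhile by blast
  ultimately show thesis using that sp by blast
qed

text \<open>Together with the number of sites, the number of folds in the image identifies the case of the
definition; it always differs from the number of folds in the argument.\<close>

lemma folds_refold:
  assumes "xs \<noteq> []" "site (fst (hd xs))"
  shows "folds xs \<noteq> 1 \<Longrightarrow> folds (refold xs) = 1"
    and "folds xs = 1 \<Longrightarrow> sites (map fst xs) \<noteq> 2 \<Longrightarrow> folds (refold xs) + 1 = sites (map fst xs)"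
    and "folds xs = 1 \<Longrightarrow> sites (map fst xs) = 2 \<Longrightarrow> folds (refold xs) \<in> {0, 2}"
    and "folds (refold xs) \<noteq> folds xs"
proof -
  obtain x xs' where x: "xs = x # xs'" using assms by (cases xs) auto
  have s: "sites (map fst xs) = Suc (sites (map fst xs'))" using assms x by (simp add: sites_def)
  show 1: "folds (refold xs) = 1" if "folds xs \<noteq> 1"
    using that x by (simp add: refold_def Let_def fold_head_def)
  show 2: "folds (refold xs) + 1 = sites (map fst xs)" if "folds xs = 1" "sites (map fst xs) \<noteq> 2"
    using that x s by (simp add: refold_def Let_def fold_tail_def)
  show 3: "folds (refold xs) \<in> {0, 2}" if "folds xs = 1" "sites (map fst xs) = 2"
    using that by (simp add: refold_def Let_def del: length_filter_map)
  show "folds (refold xs) \<noteq> folds xs"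
    using 1 2 3 by (cases "folds xs = 1"; cases "sites (map fst xs) = 2") auto
qed

lemma free_folded_aperiodic:
  assumes "e \<noteq> []" "site (hd e)" "sites e = 2" "other e \<noteq> e" "map fst zs = e"
  shows "aperiodic zs"
  unfolding aperiodic_def
proof (intro allI impI)
  fix p q assume pq: "zs = p @ q" "zs = q @ p"
  show "p = [] \<or> q = []"
  proof (rule ccontr)
    assume "\<not> ?thesis"
    then have ne: "map fst p \<noteq> []" "map fst q \<noteq> []" by auto
    have e: "e = map fst p @ map fst q" "e = map fst q @ map fst p"
      using pq assms(5) map_append by metis+
    then have "site (hd (map fst q))" using assms(2) ne by (metis hd_append2)
    from other_eq[OF e(1) ne assms(2) this assms(3)] e assms(4) show False by simp
  qed
qed

text \<open>The one unfolded site marks the starting point.\<close>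

lemma fold_tail_unique:
  assumes "e \<noteq> []" "site (hd e)"
  shows "length (filter (\<lambda>x. site (fst x) \<and> \<not> snd x) (fold_tail e)) = 1"
proof -
  have "filter (\<lambda>x. site (fst x) \<and> \<not> snd x) (all_folded (tl e)) = []"
    by (auto simp: all_folded_def filter_empty_conv)
  then show ?thesis using assms by (simp add: fold_tail_def)
qed

lemma refold_aperiodic:
  assumes "xs \<noteq> []" "site (fst (hd xs))" "\<not> symmetric xs"
  shows "aperiodic (refold xs)"
proof -
  let ?e = "map fst xs"
  have e: "?e \<noteq> []" "site (hd ?e)" using assms by (auto simp: hd_map)
  show ?thesis
  proof (cases "folds xs = 1")
    case False
    then have r: "refold xs = fold_head ?e" by (simp add: refold_def Let_def)
    then show ?thesis using folds_refold(1)[OF assms(1,2) False]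
      by (intro unique_head_aperiodic[where P = snd]) (auto simp: fold_head_def)
  next
    case f: True
    show ?thesis
    proof (cases "sites ?e = 2")
      case False
      with f have r: "refold xs = fold_tail ?e" by (simp add: refold_def Let_def)
      then show ?thesis using fold_tail_unique[OF e] e
        by (intro unique_head_aperiodic[where P = "\<lambda>x. site (fst x) \<and> \<not> snd x"])
          (auto simp: fold_tail_def)
    next
      case True
      with f assms(3) have "other ?e \<noteq> ?e" by (simp add: symmetric_def Let_def)
      from free_folded_aperiodic[OF e True this] map_fst_refold[OF assms(1)] show ?thesis by blast
    qed
  qed
qed

text \<open>The starting point is the only folded or the only unfolded site of the image, except when two
sites are treated alike; then different starting points have images with different numbers of folds.\<close>

lemma refold_inject:
  assumes "xs \<noteq> []" "site (fst (hd xs))" "ys \<noteq> []" "site (fst (hd ys))"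
    and "conjugate (refold xs) (refold ys)"
  shows "map fst xs = map fst ys"
proof -
  let ?e = "map fst xs" and ?e' = "map fst ys"
  have e: "?e \<noteq> []" "site (hd ?e)" "?e' \<noteq> []" "site (hd ?e')" using assms by (auto simp: hd_map)
  have ce: "conjugate ?e ?e'" using conjugate_map[OF assms(5), of fst] assms by simp
  then have s: "sites ?e = sites ?e'" unfolding sites_def by (rule conjugate_length_filter)
  have f: "folds (refold xs) = folds (refold ys)" using assms(5) by (rule conjugate_length_filter)
  note fx = folds_refold[OF assms(1,2)] and fy = folds_refold[OF assms(3,4)]
  have same: "folds xs = 1 \<longleftrightarrow> folds ys = 1"
    using fx(1-3) fy(1-3) f s
    by (cases "folds xs = 1"; cases "folds ys = 1"; cases "sites ?e = 2") auto
  show ?thesis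
  proof (cases "folds xs = 1")
    case False
    with same have r: "refold xs = fold_head ?e" "refold ys = fold_head ?e'"
      by (auto simp: refold_def Let_def)
    have "refold xs = refold ys"
      by (rule unique_head_conjugate_eq[where P = snd])
        (use assms(5) fx(1) False r in \<open>auto simp: fold_head_def\<close>)
    then show ?thesis using assms by (metis map_fst_refold)
  next
    case True
    note f1 = True same
    show ?thesis
    proof (cases "sites ?e = 2")
      case False
      with f1 s have r: "refold xs = fold_tail ?e" "refold ys = fold_tail ?e'"
        by (auto simp: refold_def Let_def)
      have "refold xs = refold ys"
        by (rule unique_head_conjugate_eq[where P = "\<lambda>x. site (fst x) \<and> \<not> snd x"])
          (use assms(5) fold_tail_unique[OF e(1,2)] e r in \<open>auto simp: fold_tail_def\<close>)
      then show ?thesis using assms by (metis map_fst_refold)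
    next
      case two: True
      show ?thesis
      proof (rule ccontr)
        assume ne: "?e \<noteq> ?e'"
        from ce obtain p q where pq: "?e = p @ q" "?e' = q @ p" by (auto simp: conjugate_def)
        with ne have pq0: "p \<noteq> []" "q \<noteq> []" by auto
        then have hd: "site (hd q)" "site (hd p)" using pq e(2,4) by (metis hd_append2)+
        have o: "other ?e = ?e'" "other ?e' = ?e"
          using other_eq[OF pq(1) pq0 e(2) hd(1) two]
            other_eq[OF pq(2) pq0(2,1) e(4) hd(2)] two s pq by auto
        define c where "c = (SOME z. z \<in> {?e, ?e'})"
        have c: "c \<in> {?e, ?e'}" unfolding c_def by (rule someI[of _ ?e]) simp
        have c': "(SOME z. z \<in> {?e', ?e}) = c" unfolding c_def by (simp add: insert_commute)
        have rx: "refold xs = (if c = ?e then all_free ?e else all_folded ?e)"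
          and ry: "refold ys = (if c = ?e' then all_free ?e' else all_folded ?e')"
          using f1 two s unfolding refold_def Let_def o c_def[symmetric] c' by simp_all
        from c ne have "folds (refold xs) \<noteq> folds (refold ys)"
          unfolding rx ry using two s by auto
        with f show False by simp
      qed
    qed
  qed
qed

text \<open>The two factors that begin at the sites commute, hence they are powers of a common word, and each
contains only one site.\<close>

lemma symmetric_halves:
  assumes "symmetric xs" "xs \<noteq> []" "site (fst (hd xs))"
  obtains y where "map fst xs = y @ y" "y \<noteq> []" "take (length xs div 2) (map fst xs) = y"
proof -
  let ?e = "map fst xs"
  have e: "?e \<noteq> []" "site (hd ?e)" "sites ?e = 2" "other ?e = ?e"
    using assms by (auto simp: hd_map symmetric_def Let_def)
  from other_cut[OF e(1-3)] obtain p q where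
    pq: "?e = p @ q" "p \<noteq> []" "q \<noteq> []" "site (hd q)" "sites p = 1" "sites q = 1" .
  have c: "p @ q = q @ p" using other_eq[OF pq(1-3) e(2) pq(4) e(3)] e(4) pq(1) by simp
  have "p = q"
  proof -
    from comm_append_are_replicate[OF c] obtain m n z where
      "concat (replicate m z) = p" "concat (replicate n z) = q" by blast
    moreover from this pq(5,6) have "m * sites z = 1" "n * sites z = 1"
      by (auto simp flip: sites_power)
    ultimately show ?thesis by simp
  qed
  with pq have "?e = p @ p" by simp
  moreover from this have "length xs = 2 * length p" by (metis length_append length_map mult_2)
  ultimately show thesis using that pq(2) by simp
qed

section \<open>Time reversal and the doubled word\<close>

fun flip :: "edge \<Rightarrow> edge" where
  "flip (Bm i) = Bp i"
| "flip (Bp i) = Bm i"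
| "flip Em = Ep"
| "flip Ep = Em"

text \<open>The time reversal of a path runs through the same vertices backwards and undoes every stack operation.\<close>

definition mirror :: "edge list \<Rightarrow> edge list" where
  "mirror b = map flip (rev b)"

lemma src_flip [simp]: "src (flip e) = tgt e" and tgt_flip [simp]: "tgt (flip e) = src e"
  by (cases e rule: src.cases; simp)+

lemma flip_flip [simp]: "flip (flip e) = e"
  by (cases e) auto

lemma mirror_simps: "mirror [] = []" "mirror (e # b) = mirror b @ [flip e]"
  by (simp_all add: mirror_def)

lemma walk_mirror: "walk u b v \<Longrightarrow> walk v (mirror b) u"
  by (induction b arbitrary: u) (auto simp: mirror_simps walk_append)

lemma run_mirror: "run s b = Some t \<Longrightarrow> run t (mirror b) = Some s"
  by (induction s b arbitrary: t rule: run.induct)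
    (auto simp: mirror_simps run_append split: list.splits if_splits)

text \<open>Appending the mirror image closes all brackets, so the only unmatched edge is the final \<open>\<beta>\<^sup>-(1)\<close>.
Removing the last \<open>\<beta>\<^sup>-(0)\<close> from the word of \<open>y\<close> makes room for the two final edges, and the length is exactly
twice that of the word of \<open>y\<close>.\<close>

definition doubled :: "core list \<Rightarrow> edge list" where
  "doubled y = (let E = butlast (spell (all_free y)) in E @ mirror E @ [Em, Bm I1])"

text \<open>A word with just one unmatched edge, at its end, can be rotated to such a word only trivially: a proper
rotation would make the end of either part unmatched.\<close>

lemma single_open_cut:
  assumes "b = c @ [Bm m]" "b' = c' @ [Bm m]" "run [] b = Some [m]" "run [] b' = Some [m]"
    and "b = p @ q" "b' = q @ p"
  shows "p = [] \<or> q = []"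
proof (rule ccontr)
  assume "\<not> ?thesis"
  with assms obtain p' q' where pq: "p = p' @ [Bm m]" "q = q' @ [Bm m]"
    by (metis append_butlast_last_id last_appendR last_snoc)
  from assms pq have "b = p' @ [Bm m] @ q" "b' = q' @ [Bm m] @ p" by auto
  with assms(3,4) obtain s t where st: "run [] p' = Some s" "run [] q' = Some t"
    using run_prefix by metis
  then have "run [] b = Some (m # t @ m # s)"
    using assms(5) pq by (simp add: run_append run_frame_Nil)
  with assms(3) show False by simp
qed

lemma spell_free_snoc:
  assumes "y \<noteq> []" "valids (all_free y)"
  obtains E s where "spell (all_free y) = E @ [Bm I0]" "butlast (spell (all_free y)) = E"
    "walk V0 E V0" "run [] E = Some s"
proof -
  have "all_free y \<noteq> []" using assms by (simp add: all_free_def)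
  from last_spell[OF this] obtain E where E: "spell (all_free y) = E @ [Bm I0]" by blast
  have "walk V0 E V0" using walk_spell[OF assms(2)] E by (auto simp: walk_append)
  moreover obtain s where "run [] E = Some s" using run_spell[OF assms(2)] E run_prefix by metis
  ultimately show thesis using that E by simp
qed

lemma doubled_props:
  assumes "y \<noteq> []" "valids (all_free y)"
  shows "walk V0 (doubled y) V0" "run [] (doubled y) = Some [I1]"
    "length (doubled y) = 2 * length (spell (all_free y))" "\<exists>c. doubled y = c @ [Bm I1]"
proof -
  from spell_free_snoc[OF assms] obtain E s where
    E: "spell (all_free y) = E @ [Bm I0]" "butlast (spell (all_free y)) = E"
    "walk V0 E V0" "run [] E = Some s" .
  have d: "doubled y = E @ mirror E @ [Em, Bm I1]" by (simp add: doubled_def E Let_def)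
  have m: "walk V0 (mirror E) V0" "run s (mirror E) = Some []"
    using walk_mirror[OF E(3)] run_mirror[OF E(4)] by auto
  show "walk V0 (doubled y) V0" using E m by (auto simp: d walk_append intro!: exI[of _ V0])
  show "run [] (doubled y) = Some [I1]" using E m by (simp add: d run_append)
  show "length (doubled y) = 2 * length (spell (all_free y))" by (simp add: d E mirror_def)
  show "\<exists>c. doubled y = c @ [Bm I1]" using d by simp
qed

lemma doubled_aperiodic:
  assumes "y \<noteq> []" "valids (all_free y)"
  shows "aperiodic (doubled y)"
proof -
  from doubled_props(4)[OF assms] obtain c where c: "doubled y = c @ [Bm I1]" by blast
  show ?thesis unfolding aperiodic_def
    using single_open_cut[OF c c doubled_props(2)[OF assms] doubled_props(2)[OF assms]] by blast
qed

lemma doubled_inject: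
  assumes "y \<noteq> []" "valids (all_free y)" "z \<noteq> []" "valids (all_free z)"
    and "conjugate (doubled y) (doubled z)"
  shows "y = z"
proof -
  from doubled_props(4)[OF assms(1,2)] doubled_props(4)[OF assms(3,4)] obtain c c' where
    c: "doubled y = c @ [Bm I1]" "doubled z = c' @ [Bm I1]" by blast
  from assms(5) obtain p q where pq: "doubled y = p @ q" "doubled z = q @ p" by (auto simp: conjugate_def)
  have "p = [] \<or> q = []"
    using single_open_cut[OF c doubled_props(2)[OF assms(1,2)] doubled_props(2)[OF assms(3,4)] pq] .
  with pq have eq: "doubled y = doubled z" by auto
  from spell_free_snoc[OF assms(1,2)] obtain E where
    E: "spell (all_free y) = E @ [Bm I0]" "butlast (spell (all_free y)) = E" by metis
  from spell_free_snoc[OF assms(3,4)] obtain F where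
    F: "spell (all_free z) = F @ [Bm I0]" "butlast (spell (all_free z)) = F" by metis
  have "E @ mirror E = F @ mirror F" using eq by (simp add: doubled_def Let_def E(2) F(2))
  moreover from this have "length E = length F"
    by (metis (no_types, lifting) add_self_div_2 length_append length_map length_rev mirror_def)
  ultimately have "E = F" by simp
  with E F have "spell (all_free y) = spell (all_free z)" by simp
  from spell_inject[OF assms(2,4) this] show ?thesis by (metis map_fst_free)
qed

section \<open>The injection on words\<close>

definition image_word :: "(core \<times> bool) list \<Rightarrow> edge list" where
  "image_word xs = (if symmetric xs
     then doubled (take (length xs div 2) (map fst xs)) else spell (refold xs))"

lemma image_word_cases:
  assumes "valids xs" "xs \<noteq> []" "site (fst (hd xs))"
  obtains (symmetric) y where "symmetric xs" "y \<noteq> []" "valids (all_free y)" "map fst xs = y @ y"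
      "image_word xs = doubled y" "2 * length (spell (all_free y)) = length (spell xs)"
    | (refold) "\<not> symmetric xs" "valids (refold xs)" "image_word xs = spell (refold xs)"
proof (cases "symmetric xs")
  case True
  from symmetric_halves[OF True assms(2,3)] obtain y where
    y: "map fst xs = y @ y" "y \<noteq> []" "take (length xs div 2) (map fst xs) = y" .
  have v: "valids (all_free y)" by (rule valids_free[OF assms(1)]) (use y(1) in \<open>simp flip: set_map\<close>)
  moreover have "length (spell (all_free y @ all_free y)) = length (spell xs)"
    by (rule length_spell) (use v assms(1) y(1) in auto)
  ultimately show thesis using symmetric[OF True y(2) v y(1)] y(3) True by (simp add: image_word_def)
next
  case False
  with refold valids_refold[OF assms] show thesis by (simp add: image_word_def)
qed

lemma weight_run: "run [] b = Some s \<Longrightarrow> weight m b = int (count_list s m)"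
  using run_weight[of "[]" b s m] by simp

lemma count_list_rev: "count_list (rev xs) x = count_list xs x"
  by (induction xs) auto

lemma weight_spell: "valids xs \<Longrightarrow> weight m (spell xs) = int (count_list (letters xs) m)"
  using weight_run[OF run_spell] by (simp add: count_list_rev)

lemma image_word_props:
  assumes "valids xs" "xs \<noteq> []" "site (fst (hd xs))"
  shows "length (image_word xs) = length (spell xs)" "walk V0 (image_word xs) V0"
    "aperiodic (image_word xs)" "\<exists>s. s \<noteq> [] \<and> run [] (image_word xs) = Some s"
proof -
  have r: "map fst (refold xs) = map fst xs" using assms by simp
  then have ne: "refold xs \<noteq> []" using assms(2) by (metis list.map_disc_iff)
  have "length (image_word xs) = length (spell xs) \<and> walk V0 (image_word xs) V0 \<and>
    aperiodic (image_word xs) \<and> (\<exists>s. s \<noteq> [] \<and> run [] (image_word xs) = Some s)"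
    using assms
  proof (cases rule: image_word_cases)
    case (symmetric y)
    with doubled_props[OF symmetric(2,3)] doubled_aperiodic[OF symmetric(2,3)] show ?thesis by simp
  next
    case refold
    have "rev (letters (refold xs)) \<noteq> []" using ne by (cases "refold xs") auto
    then show ?thesis
      using refold length_spell[OF refold(2) assms(1) r] walk_spell[OF refold(2)] run_spell[OF refold(2)]
        spell_aperiodic[OF refold(2) refold_aperiodic[OF assms(2,3) refold(1)]] by metis
  qed
  then show "length (image_word xs) = length (spell xs)" "walk V0 (image_word xs) V0"
    "aperiodic (image_word xs)" "\<exists>s. s \<noteq> [] \<and> run [] (image_word xs) = Some s" by auto
qed

text \<open>Powers of a representative of \<open>\<mu>\<close> with the same number of letters \<open>\<alpha>(0)\<close> agree also in the number of
letters \<open>\<alpha>(1)\<close>, and the former number is not zero if the representative ends with \<open>\<alpha>(0)\<close>; so by this the image does not have multiplier \<open>\<mu>\<close>.\<close>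

lemma image_word_weight:
  assumes "valids xs" "xs \<noteq> []" "site (fst (hd xs))"
  shows "weight I0 (image_word xs) = 0 \<or>
    weight I0 (image_word xs) = weight I0 (spell xs) \<and> weight I1 (image_word xs) \<noteq> weight I1 (spell xs)"
  using assms
proof (cases rule: image_word_cases)
  case (symmetric y)
  with weight_run[OF doubled_props(2)[OF symmetric(2,3)], of I0] show ?thesis by simp
next
  case refold
  have r: "map fst (refold xs) = map fst xs" using assms by simp
  then have "length (refold xs) = length xs" by (metis length_map)
  moreover have "count_list (letters (refold xs)) I1 + folds (refold xs)
      = count_list (letters xs) I1 + folds xs"
    unfolding count_letters_I1[OF refold(2)] count_letters_I1[OF assms(1)] r ..
  with folds_refold(4)[OF assms(2,3)]
  have "count_list (letters (refold xs)) I1 \<noteq> count_list (letters xs) I1" by linarith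
  ultimately show ?thesis
    unfolding refold(3) weight_spell[OF refold(2)] weight_spell[OF assms(1)] count_letters_I0 by simp
qed

text \<open>The doubled words are kept apart from the others by having no unmatched \<open>\<beta>\<^sup>-(0)\<close>.\<close>

lemma image_word_inject:
  assumes "valids xs" "xs \<noteq> []" "site (fst (hd xs))"
    and "valids ys" "ys \<noteq> []" "site (fst (hd ys))"
    and "conjugate (image_word xs) (image_word ys)"
  shows "map fst xs = map fst ys"
proof -
  have mixed: False if "y \<noteq> []" "valids (all_free y)" "valids zs" "zs \<noteq> []" "conjugate (doubled y) (spell zs)"
    for y zs
    using weight_conjugate[OF that(5), of I0] weight_run[OF doubled_props(2)[OF that(1,2)], of I0] that(4)
    by (simp add: weight_spell[OF that(3)] count_letters_I0)
  have ne: "refold xs \<noteq> []" "refold ys \<noteq> []"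
    using map_fst_refold assms(2,5) by (metis list.map_disc_iff)+
  from assms(1-3) show ?thesis
  proof (cases rule: image_word_cases)
    case x: (symmetric y)
    from assms(4-6) show ?thesis
    proof (cases rule: image_word_cases)
      case (symmetric z)
      with x assms(7) doubled_inject[of y z] show ?thesis by simp
    next
      case refold
      with x assms(7) mixed[of y "refold ys"] ne show ?thesis by simp
    qed
  next
    case x: refold
    from assms(4-6) show ?thesis
    proof (cases rule: image_word_cases)
      case (symmetric z)
      with x conjugate_sym[OF assms(7)] mixed[of z "refold xs"] ne show ?thesis by simp
    next
      case refold
      with x assms(7) have "conjugate (refold xs) (refold ys)" using spell_conjugate by simp
      from refold_inject[OF assms(2,3,5,6) this] show ?thesis .
    qed
  qed
qed

section \<open>Periodic points and words\<close>

definition point :: "'a list \<Rightarrow> int \<Rightarrow> 'a" where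
  "point b i = b ! nat (i mod int (length b))"

lemma shift_power: "(shift ^^ n) p = (\<lambda>i. p (i + int n))"
  by (induction n) (auto simp: shift_def algebra_simps)

lemma period_mult:
  assumes "\<And>i. p (i + n) = p i" shows "p (i + n * z) = p (i::int)"
proof (induction z rule: int_induct[where k = 0])
  case (step1 z)
  then show ?case using assms[of "i + n * z"] by (simp add: algebra_simps)
next
  case (step2 z)
  then show ?case using assms[of "i + n * (z - 1)"] by (simp add: algebra_simps)
qed simp

lemma point_block:
  assumes "n > 0" "\<And>i. p (i + int n) = p i"
  shows "point (block p a n) i = p (a + i)"
proof -
  have "nat (i mod int n) < n" using assms(1) by (simp add: nat_less_iff)
  then have "point (block p a n) i = p (a + i mod int n)" using assms(1) by (simp add: point_def)
  also have "\<dots> = p (a + i mod int n + int n * (i div int n))"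
    using period_mult[of p "int n"] assms(2) by metis
  also have "a + i mod int n + int n * (i div int n) = a + i" by simp
  finally show ?thesis .
qed

lemma block_point: "block (point b) 0 (length b) = b"
  by (rule nth_equalityI) (auto simp: point_def)

lemma point_period: "point b (i + int (length b)) = point b i"
  by (simp add: point_def)

lemma block_period:
  assumes "\<And>i. p (i + int n) = p i" shows "block p (i + int n) m = block p i m"
proof -
  have "p (i + int n + int k) = p (i + int k)" for k
    using assms[of "i + int k"] by (simp add: algebra_simps)
  then show ?thesis by (simp add: block_def)
qed

lemma block_point_rotate:
  assumes "b = u @ v"
  shows "block (point b) (int (length u)) (length b) = v @ u"
proof -
  have "b = block (point b) 0 (length u) @ block (point b) (int (length u)) (length v)"
    using block_add[of "point b" 0 "length u" "length v"] block_point[of b] assms by simp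
  then have u: "block (point b) 0 (length u) = u" and v: "block (point b) (int (length u)) (length v) = v"
    using assms by (metis append_eq_append_conv length_block)+
  have "block (point b) (int (length u)) (length v + length u)
      = v @ block (point b) (0 + int (length b)) (length u)"
    using block_add[of "point b" "int (length u)" "length v" "length u"] v assms by simp
  also have "block (point b) (0 + int (length b)) (length u) = u"
    unfolding block_period[of "point b", OF point_period] by (rule u)
  finally show ?thesis using assms by (simp add: add.commute)
qed

lemma shift_orbit_shifted: "shift_orbit (\<lambda>i. p (a + i)) = shift_orbit p"
  unfolding shift_orbit_def
proof (intro equalityI subsetI; clarify)
  fix k
  show "(\<lambda>i. p (a + (i + k))) \<in> range (\<lambda>k i. p (i + k))"
    by (rule image_eqI[of _ _ "a + k"]) (auto simp: algebra_simps)
  show "(\<lambda>i. p (i + k)) \<in> range (\<lambda>k i. p (a + (i + k)))"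
    by (rule image_eqI[of _ _ "k - a"]) (auto simp: algebra_simps)
qed

lemma conjugate_imp_orbit:
  assumes "conjugate b c" "b \<noteq> []"
  shows "shift_orbit (point c) = shift_orbit (point b)"
proof -
  from assms obtain u v where uv: "b = u @ v" "c = v @ u" by (auto simp: conjugate_def)
  have "point c = (\<lambda>i. point b (int (length u) + i))"
    using point_block[of "length b" "point b" "int (length u)", OF _ point_period]
      block_point_rotate[OF uv(1)] assms(2) uv(2) by auto
  then show ?thesis using shift_orbit_shifted by metis
qed

lemma orbit_imp_conjugate:
  assumes "shift_orbit (point b) = shift_orbit (point c)" "length b = length c" "b \<noteq> []"
  shows "conjugate b c"
proof -
  let ?n = "length b"
  have "point c \<in> shift_orbit (point c)"
    unfolding shift_orbit_def by (rule image_eqI[of _ _ 0]) auto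
  with assms(1) obtain k where k: "point c = (\<lambda>i. point b (i + k))" by (auto simp: shift_orbit_def)
  define a where "a = nat (k mod int ?n)"
  have a: "a < ?n" "int a = k mod int ?n" using assms(3) by (auto simp: a_def nat_less_iff)
  have pc: "point c i = point b (int a + i)" for i
  proof -
    have "i + k = i + k mod int ?n + int ?n * (k div int ?n)" by simp
    then have "point c i = point b (i + k mod int ?n + int ?n * (k div int ?n))"
      unfolding k by (rule arg_cong)
    also have "\<dots> = point b (i + k mod int ?n)" using period_mult[of "point b" "int ?n"] point_period by metis
    also have "i + k mod int ?n = int a + i" using a(2) by simp
    finally show ?thesis .
  qed
  have "c = block (point c) 0 ?n" using block_point[of c] assms(2) by simp
  also have "\<dots> = block (point b) (int a) ?n" by (simp add: block_def pc)
  also have "\<dots> = drop a b @ take a b"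
    using block_point_rotate[of b "take a b" "drop a b"] a by simp
  finally show ?thesis unfolding conjugate_def by (metis append_take_drop_id)
qed

lemma least_period_pos: "periodic p \<Longrightarrow> least_period p > 0 \<and> (\<forall>i. p (i + int (least_period p)) = p i)"
  unfolding periodic_def least_period_def
  by (drule LeastI_ex) (auto simp: shift_power fun_eq_iff)

lemma least_period_point:
  assumes "aperiodic b" "b \<noteq> []"
  shows "periodic (point b) \<and> least_period (point b) = length b"
proof -
  have per: "length b > 0 \<and> (shift ^^ length b) (point b) = point b"
    using assms by (simp add: shift_power point_period)
  moreover have "length b \<le> k" if "k > 0 \<and> (shift ^^ k) (point b) = point b" for k
  proof (rule ccontr)
    assume "\<not> ?thesis"
    then have k: "k < length b" by simp
    from that have "block (point b) (0 + int k) (length b) = block (point b) 0 (length b)"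
      by (intro block_period) (auto simp: shift_power fun_eq_iff)
    then have "drop k b @ take k b = b"
      using block_point_rotate[of b "take k b" "drop k b"] k block_point[of b] by simp
    with assms(1) have "take k b = [] \<or> drop k b = []"
      unfolding aperiodic_def by (metis append_take_drop_id)
    with k that assms(2) show False by auto
  qed
  ultimately show ?thesis unfolding periodic_def least_period_def
    by (blast intro: Least_equality)
qed

lemma aperiodic_block:
  assumes "periodic p" "n = least_period p"
  shows "aperiodic (block p i n)"
  unfolding aperiodic_def
proof (intro allI impI, rule ccontr)
  fix u v assume b: "block p i n = u @ v" "block p i n = v @ u" and ne: "\<not> (u = [] \<or> v = [])"
  have n: "n > 0" "\<And>i. p (i + int n) = p i" using least_period_pos[OF assms(1)] assms(2) by auto
  let ?b = "block p i n"
  have pb: "point ?b j = p (i + j)" for j using point_block[of n p, OF n] .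
  have "block (point ?b) (int (length u)) n = ?b"
    using block_point_rotate[OF b(1)] b(2)[symmetric] by (simp only: length_block)
  then have "point ?b j = point ?b (int (length u) + j)" for j
    using point_block[of n "point ?b" "int (length u)" j] n(1) point_period[of ?b] by simp
  note per = this
  have "p (j + int (length u)) = p j" for j
  proof -
    have "p (j + int (length u)) = p (i + (int (length u) + (j - i)))" by (simp add: algebra_simps)
    also have "\<dots> = point ?b (j - i)" unfolding pb[symmetric] by (rule per[symmetric])
    also have "\<dots> = p j" by (simp add: pb)
    finally show ?thesis .
  qed
  then have "(shift ^^ length u) p = p" by (simp add: shift_power)
  with ne have "least_period p \<le> length u" unfolding least_period_def by (intro Least_le) auto
  moreover have "n = length u + length v" using b(1) by (metis length_append length_block)
  ultimately show False using ne assms(2) by (cases v) auto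
qed

lemma walk_iff_directed_path:
  "walk u b v \<longleftrightarrow> (if b = [] then u = v
    else src (hd b) = u \<and> tgt (last b) = v \<and> directed_path b)"
  by (induction b arbitrary: u) (auto simp: directed_path_def successively_Cons)

lemma minus_word_power: "minus_word w ^ k = minus_word (concat (replicate k w))"
  by (induction k) auto

text \<open>Every factor of the periodic point is a factor of a power of the word, and the label of that power is
a product of generators \<open>\<alpha>\<^sub>-\<close>, hence not zero.\<close>

lemma point_in_fib_dyck:
  assumes "walk u b u" "run [] b = Some s" "b \<noteq> []"
  shows "point b \<in> fib_dyck"
proof -
  let ?n = "length b"
  have n: "?n > 0" using assms by simp
  have step: "tgt (point b i) = src (point b (i + 1))" for i
  proof -
    define k where "k = nat (i mod int ?n)"
    have k: "k < ?n" "int k = i mod int ?n" using n by (auto simp: k_def nat_less_iff)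
    have "(i + 1) mod int ?n = (int k + 1) mod int ?n" unfolding k(2) by (simp add: mod_add_left_eq)
    also have "\<dots> = (if Suc k = ?n then 0 else int (Suc k))"
    proof (cases "Suc k = ?n")
      case True
      then have "int k + 1 = int ?n" by linarith
      then have "(int k + 1) mod int ?n = 0" by (metis mod_self)
      then show ?thesis using True by simp
    next
      case False
      with k(1) show ?thesis by simp
    qed
    finally have s: "nat ((i + 1) mod int ?n) = (if Suc k = ?n then 0 else Suc k)"
      by (simp del: of_nat_Suc)
    show ?thesis
    proof (cases "Suc k = ?n")
      case True
      then have "b ! k = last b" "b ! 0 = hd b" using assms(3)
        by (metis diff_Suc_1 last_conv_nth, simp add: hd_conv_nth)
      then show ?thesis using assms(1,3) s True by (simp add: point_def k_def[symmetric] walk_iff_directed_path)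
    next
      case False
      then show ?thesis using assms(1,3) s k(1)
        by (simp add: point_def k_def[symmetric] walk_iff_directed_path directed_path_def successively_conv_nth)
    qed
  qed
  have lab: "path_label b = minus_word (rev s)" using assms(2) by (simp add: label_eq_minus_word_iff)
  have pow: "block (point b) (int ?n * z) (k * ?n) = concat (replicate k b)" for z k
  proof (induction k arbitrary: z)
    case (Suc k)
    have "block (point b) (0 + int ?n * z) ?n = block (point b) 0 ?n"
      using period_mult[of "point b" "int ?n", OF point_period]
      by (auto simp: block_def) (metis (no_types, lifting) add.commute)
    then have "block (point b) (int ?n * z) ?n = b" using block_point by simp
    moreover have "block (point b) (int ?n * z + int ?n) (k * ?n) = concat (replicate k b)"
      using Suc.IH[of "z + 1"] by (simp add: algebra_simps)
    ultimately show ?case using block_add[of "point b" "int ?n * z" ?n "k * ?n"] by simp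
  qed (simp add: block_def)
  have "path_label (concat (replicate k b)) = minus_word (concat (replicate k (rev s)))" for k
    by (induction k) (simp_all add: path_label_append lab, simp add: path_label_def)
  then have nz: "path_label (concat (replicate k b)) \<noteq> 0" for k using minus_word_nonzero by simp
  have "path_label (block (point b) i m) \<noteq> 0" for i m
  proof
    assume z: "path_label (block (point b) i m) = 0"
    define a where "a = nat (i mod int ?n)"
    have a: "int a = i mod int ?n" using n by (simp add: a_def)
    \<comment> \<open>The power \<open>a + m\<close> is long enough to cover the factor and the \<open>a\<close> edges before it.\<close>
    define r where "r = (a + m) * ?n - (a + m)"
    have "a + m \<le> (a + m) * ?n" using n by (cases ?n) auto
    then have r: "(a + m) * ?n = a + (m + r)" unfolding r_def by linarith
    have i: "int ?n * (i div int ?n) + int a = i" unfolding a by simp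
    have "concat (replicate (a + m) b)
        = block (point b) (int ?n * (i div int ?n)) a @ block (point b) i m @ block (point b) (i + int m) r"
      using pow[of "i div int ?n" "a + m"] unfolding r block_add i by simp
    with z nz[of "a + m"] show False by (simp add: path_label_append)
  qed
  then show ?thesis
    using step by (auto simp: fib_dyck_def directed_path_def successively_conv_nth algebra_simps)
qed

lemma fib_dyck_step: "p \<in> fib_dyck \<Longrightarrow> tgt (p i) = src (p (i + 1))"
proof -
  assume "p \<in> fib_dyck"
  then have "directed_path (block p i 2)" by (simp add: fib_dyck_def)
  then show ?thesis by (simp add: block_def directed_path_def numeral_2_eq_2)
qed

lemma walk_block: "p \<in> fib_dyck \<Longrightarrow> walk (src (p i)) (block p i n) (src (p (i + int n)))"
proof (induction n arbitrary: i)
  case (Suc n)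
  have "block p i (Suc n) = p i # block p (i + 1) n"
    using block_add[of p i 1 n] by (simp add: block_def)
  then show ?case using Suc.IH[OF Suc.prems, of "i + 1"] fib_dyck_step[OF Suc.prems, of i]
    by (simp add: algebra_simps)
qed (simp add: block_def)

lemma minus_word_in_dyck_minus: "ms \<noteq> [] \<Longrightarrow> minus_word ms \<in> dyck_minus"
proof (induction ms rule: list_nonempty_induct)
  case (single m)
  then show ?case by (auto simp: dyck_minus_def intro: semigroup_gen.base)
next
  case (cons m ms)
  then show ?case by (auto simp: dyck_minus_def intro: semigroup_gen.intros)
qed

lemma orbit_in_orbits_minus:
  assumes "walk V0 b V0" "run [] b = Some s" "s \<noteq> []" "aperiodic b"
  shows "shift_orbit (point b) \<in> orbits_minus (length b)"
proof -
  have b: "b \<noteq> []" using assms by auto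
  note p = least_period_point[OF assms(4) b]
  have "path_label (block (point b) 0 (length b)) = minus_word (rev s)"
    unfolding block_point label_eq_minus_word_iff using assms(2) by simp
  with assms(3) have "has_negative_multiplier (point b)"
    unfolding has_negative_multiplier_def using p minus_word_in_dyck_minus by (metis rev_is_Nil_conv)
  with p point_in_fib_dyck[OF assms(1,2) b] show ?thesis
    by (auto simp: orbits_minus_def orbits_with_def)
qed

lemma concat_replicate_Suc: "concat (replicate (Suc j) z) = concat (replicate j z) @ z"
  by (induction j) simp_all

lemma conjugate_power:
  assumes "conjugate w w'" "k \<ge> 1"
  shows "conjugate (concat (replicate k w)) (concat (replicate k w'))"
proof -
  from assms(1) obtain a c where w: "w = a @ c" "w' = c @ a" by (auto simp: conjugate_def)
  obtain j where k: "k = Suc j" using assms(2) by (cases k) auto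
  have "concat (replicate j (a @ c)) @ a = a @ concat (replicate j (c @ a))" for j
    by (induction j) auto
  then have "concat (replicate k w) = a @ (concat (replicate j (c @ a)) @ c)"
    "concat (replicate k w') = (concat (replicate j (c @ a)) @ c) @ a"
    unfolding k w concat_replicate_Suc by (simp_all only: append.assoc[symmetric])
  then show ?thesis unfolding conjugate_def by blast
qed

text \<open>A period whose label is a power of some representative of \<open>\<mu>\<close> may begin at vertex 1 and in the
middle of a block. The prescribed representative ends with \<open>\<alpha>(0)\<close>; starting after the unmatched \<open>\<beta>\<^sup>-(0)\<close> that
carries this letter cures both and yields the prescribed representative.\<close>

lemma orbits_mult_minus_normal_form:
  assumes "Q \<in> orbits_mult_minus n \<mu>" "\<And>w. w \<in> \<mu> \<Longrightarrow> conjugate w (w0 @ [I0])"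
  obtains xs k where "valids xs" "k \<ge> 1" "letters xs = concat (replicate k (w0 @ [I0]))"
    "length (spell xs) = n" "Q = shift_orbit (point (spell xs))" "aperiodic (spell xs)"
proof -
  from assms(1) obtain p where p: "p \<in> fib_dyck" "periodic p" "least_period p = n"
    "has_multiplier_minus \<mu> p" "Q = shift_orbit p"
    by (auto simp: orbits_mult_minus_def orbits_with_def)
  then obtain i w k where w: "w \<in> \<mu>" "k \<ge> 1"
    "path_label (block p i n) = minus_word (concat (replicate k w))"
    by (auto simp: has_multiplier_minus_def minus_word_power)
  define b where "b = block p i n"
  let ?W = "concat (replicate k w)" and ?Z = "concat (replicate k (w0 @ [I0]))"
  have rb: "run [] b = Some (rev ?W)" using w(3) by (simp add: label_eq_minus_word_iff b_def)
  from conjugate_power[OF assms(2)[OF w(1)] w(2)] obtain A1 B1 where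
    AB1: "?W = A1 @ B1" "?Z = B1 @ A1" unfolding conjugate_def by blast
  have W0: "?Z = (concat (replicate (k - 1) (w0 @ [I0])) @ w0) @ [I0]" (is "_ = ?V @ _")
  proof -
    obtain j where "k = Suc j" using w(2) by (cases k) auto
    then show ?thesis by (simp only: concat_replicate_Suc append.assoc diff_Suc_1)
  qed
  \<comment> \<open>If the rotation is trivial, the final letter of the whole power takes the role of the cut.\<close>
  have "\<exists>A B. ?W = (A @ [I0]) @ B \<and> ?Z = B @ A @ [I0]"
  proof (cases A1 rule: rev_cases)
    case Nil
    with AB1 W0 show ?thesis by (intro exI[of _ ?V] exI[of _ "[]"]) (metis append_Nil append_Nil2)
  next
    case (snoc A' x)
    with AB1 W0 have "x = I0" by (metis append.assoc last_snoc)
    with AB1 snoc show ?thesis by (intro exI[of _ A'] exI[of _ B1]) simp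
  qed
  then obtain A B where AB: "?W = (A @ [I0]) @ B" "?Z = B @ A @ [I0]" by blast
  from rb AB have "run [] b = Some (rev B @ I0 # rev A)" by simp
  from run_split[OF this] obtain c N where
    c: "b = c @ Bm I0 # N" "run [] c = Some (rev A)" "run [] N = Some (rev B)" by blast
  have n: "n > 0" "\<And>i. p (i + int n) = p i" using least_period_pos[OF p(2)] p(3) by auto
  have "walk (src (p i)) b (src (p i))" using walk_block[OF p(1), of i n] n(2) by (simp add: b_def)
  with c(1) have wNc: "walk V0 (N @ c) V0" by (auto simp: walk_append_Cons walk_append)
  have rNc: "run [] (N @ c) = Some (rev A @ rev B)" using c by (simp add: run_append run_frame_Nil)
  from spell_exists_closed[OF wNc rNc] obtain xs where
    xs: "valids xs" "xs \<noteq> []" "(N @ c) @ [Bm I0] = spell xs" by blast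
  have "run [] (spell xs) = Some (I0 # rev A @ rev B)"
    unfolding xs(3)[symmetric] run_append[of _ "N @ c"] rNc by simp
  then have "rev (letters xs) = rev ?Z" unfolding run_spell[OF xs(1)] AB(2) by simp
  then have l: "letters xs = ?Z" by (simp only: rev_is_rev_conv)
  have cy: "conjugate b (spell xs)" unfolding conjugate_def
    by (rule exI[of _ "c @ [Bm I0]"], rule exI[of _ N]) (use c(1) xs(3) in simp)
  have len: "length (spell xs) = n" using conjugate_length[OF cy] by (simp add: b_def)
  have "point b = (\<lambda>j. p (i + j))" unfolding b_def using point_block[of n p, OF n] by auto
  then have "Q = shift_orbit (point b)" using p(5) shift_orbit_shifted by metis
  then have Q: "Q = shift_orbit (point (spell xs))" using conjugate_imp_orbit[OF cy] c(1) by simp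
  have "aperiodic b" unfolding b_def using aperiodic_block[OF p(2)] p(3) by simp
  then have "aperiodic (spell xs)"
  proof -
    have "least_period (point b) = n" "periodic (point b)"
      using least_period_point[OF \<open>aperiodic b\<close>] c(1) by (simp_all add: b_def)
    from cy obtain u v where uv: "b = u @ v" "spell xs = v @ u" by (auto simp: conjugate_def)
    have "spell xs = block (point b) (int (length u)) n"
      using block_point_rotate[OF uv(1)] uv(2) by (simp add: b_def)
    then show ?thesis using aperiodic_block[OF \<open>periodic (point b)\<close>] \<open>least_period (point b) = n\<close> by simp
  qed
  with that[OF xs(1) w(2) l len Q] show thesis .
qed

section \<open>Counting orbits\<close>

lemma count_list_power: "count_list (concat (replicate k w)) m = k * count_list w m"
  by (induction k) auto

lemma card_orbits_mult_minus:
  assumes \<mu>: "\<And>w. w \<in> \<mu> \<Longrightarrow> conjugate w (I1 # w0 @ [I0])"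
  shows "2 * card (orbits_mult_minus n \<mu>) \<le> card (orbits_minus n)"
    and "finite (orbits_mult_minus n \<mu>)"
proof -
  let ?W = "I1 # w0 @ [I0]" and ?M = "orbits_mult_minus n \<mu>"
  define ok where "ok xs k \<longleftrightarrow> valids xs \<and> xs \<noteq> [] \<and> site (fst (hd xs)) \<and> k \<ge> 1 \<and>
    letters xs = concat (replicate k ?W) \<and> length (spell xs) = n \<and> aperiodic (spell xs)" for xs k
  have rep: "\<exists>xs k. ok xs k \<and> Q = shift_orbit (point (spell xs))" if "Q \<in> ?M" for Q
  proof -
    have c: "conjugate w ((I1 # w0) @ [I0])" if "w \<in> \<mu>" for w using \<mu>[OF that] by simp
    from orbits_mult_minus_normal_form[OF \<open>Q \<in> ?M\<close> c] obtain xs k where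
      xs: "valids xs" "k \<ge> 1" "letters xs = concat (replicate k ((I1 # w0) @ [I0]))"
        "length (spell xs) = n" "Q = shift_orbit (point (spell xs))" "aperiodic (spell xs)" .
    have l: "letters xs = I1 # w0 @ [I0] @ concat (replicate (k - 1) ?W)"
      using xs(2,3) by (cases k) auto
    then obtain x xs' where x: "xs = x # xs'" by (cases xs) auto
    \<comment> \<open>The first block carries the initial \<open>\<alpha>(1)\<close>, and only sites carry such letters.\<close>
    have "ones x \<noteq> 0" using l x by (cases "ones x") auto
    then have "site (fst x)" by (cases x rule: ones.cases) (auto simp: site_def)
    with xs(1-4,6) x have "ok xs k" by (simp add: ok_def)
    with xs(5) show ?thesis by blast
  qed
  then obtain r where r: "\<And>Q. Q \<in> ?M \<Longrightarrow> \<exists>k. ok (r Q) k \<and> Q = shift_orbit (point (spell (r Q)))"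
    by metis
  define \<Phi> where "\<Phi> Q = shift_orbit (point (image_word (r Q)))" for Q
  have weights: "weight I0 (spell xs) = int k * int (count_list ?W I0) \<and>
      weight I1 (spell xs) = int k * int (count_list ?W I1)" if "ok xs k" for xs k
    using that unfolding ok_def by (metis count_list_power of_nat_mult weight_spell)
  have ne: "spell xs \<noteq> []" if "ok xs k" for xs k using that by (cases xs) (auto simp: ok_def)
  have props: "length (image_word xs) = n \<and> image_word xs \<noteq> []" if "ok xs k" for xs k
  proof -
    have "length (image_word xs) = length (spell xs)"
      using image_word_props(1) that by (simp add: ok_def)
    with ne[OF that] that show ?thesis by (auto simp: ok_def)
  qed
  have sub: "?M \<subseteq> orbits_minus n"
  proof
    fix Q assume "Q \<in> ?M"
    from r[OF this] obtain k where k: "ok (r Q) k" "Q = shift_orbit (point (spell (r Q)))" by blast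
    then have v: "valids (r Q)" "aperiodic (spell (r Q))" "length (spell (r Q)) = n" by (auto simp: ok_def)
    have "rev (letters (r Q)) \<noteq> []" using k(1) by (cases "r Q") (auto simp: ok_def)
    from orbit_in_orbits_minus[OF walk_spell[OF v(1)] run_spell[OF v(1)] this v(2)] v(3) k(2)
    show "Q \<in> orbits_minus n" by simp
  qed
  have im: "\<Phi> ` ?M \<subseteq> orbits_minus n - ?M"
  proof (intro image_subsetI DiffI notI)
    fix Q assume Q: "Q \<in> ?M"
    from r[OF this] obtain k where k: "ok (r Q) k" by blast
    then have v: "valids (r Q)" "r Q \<noteq> []" "site (fst (hd (r Q)))" by (auto simp: ok_def)
    from image_word_props(4)[OF v] obtain s where s: "s \<noteq> []" "run [] (image_word (r Q)) = Some s"
      by blast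
    from orbit_in_orbits_minus[OF image_word_props(2)[OF v] s(2,1) image_word_props(3)[OF v]] props[OF k]
    show "\<Phi> Q \<in> orbits_minus n" by (simp add: \<Phi>_def)
    assume "\<Phi> Q \<in> ?M"
    from rep[OF this] obtain ys j where
      ys: "ok ys j" "shift_orbit (point (image_word (r Q))) = shift_orbit (point (spell ys))"
      by (auto simp: \<Phi>_def)
    have "conjugate (image_word (r Q)) (spell ys)"
      using orbit_imp_conjugate[OF ys(2)] props[OF k] ys(1) by (auto simp: ok_def)
    then have w: "weight m (image_word (r Q)) = weight m (spell ys)" for m by (rule weight_conjugate)
    have "j \<ge> 1" using ys(1) by (simp add: ok_def)
    then have "weight I0 (spell ys) \<noteq> 0" using weights[OF ys(1)] by simp
    with image_word_weight[OF v] w have e: "weight I0 (spell ys) = weight I0 (spell (r Q))"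
      "weight I1 (spell ys) \<noteq> weight I1 (spell (r Q))" by auto
    \<comment> \<open>Equally many \<open>\<alpha>(0)\<close> force the same exponent, contradicting the different numbers of \<open>\<alpha>(1)\<close>.\<close>
    have "int (count_list ?W I0) \<noteq> 0" by simp
    with e(1) weights[OF ys(1)] weights[OF k] have "j = k" by simp
    with e(2) weights[OF ys(1)] weights[OF k] show False by simp
  qed
  have inj: "inj_on \<Phi> ?M"
  proof (rule inj_onI)
    fix Q R assume QR: "Q \<in> ?M" "R \<in> ?M" "\<Phi> Q = \<Phi> R"
    from r[OF QR(1)] r[OF QR(2)] obtain k j where
      k: "ok (r Q) k" "Q = shift_orbit (point (spell (r Q)))" and
      j: "ok (r R) j" "R = shift_orbit (point (spell (r R)))" by blast
    have "conjugate (image_word (r Q)) (image_word (r R))"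
      using orbit_imp_conjugate[OF QR(3)[unfolded \<Phi>_def]] props[OF k(1)] props[OF j(1)] by simp
    then have e: "map fst (r Q) = map fst (r R)"
      using image_word_inject[of "r Q" "r R"] k(1) j(1) unfolding ok_def by blast
    then have "length (r Q) = length (r R)" by (metis length_map)
    then have "k * count_list ?W I0 = j * count_list ?W I0"
      using k(1) j(1) unfolding ok_def by (metis count_letters_I0 count_list_power)
    moreover have "count_list ?W I0 \<noteq> 0" by simp
    ultimately have "k = j" by (metis mult_cancel2)
    then have "letters (r Q) = letters (r R)" using k(1) j(1) by (simp add: ok_def)
    then have "r Q = r R" using letters_inject[OF _ _ e] k(1) j(1) unfolding ok_def by blast
    with k(2) j(2) show "Q = R" by simp
  qed
  have fin: "finite (orbits_minus n)"
  proof (rule finite_subset)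
    show "orbits_minus n \<subseteq> (\<lambda>b. shift_orbit (point b)) ` {b. set b \<subseteq> UNIV \<and> length b = n}"
    proof
      fix Q assume "Q \<in> orbits_minus n"
      then obtain p where p: "periodic p" "least_period p = n" "Q = shift_orbit p"
        by (auto simp: orbits_minus_def orbits_with_def)
      have n: "n > 0" "\<And>i. p (i + int n) = p i" using least_period_pos[OF p(1)] p(2) by auto
      have "point (block p 0 n) = p" using point_block[of n p 0, OF n] by auto
      with p(3) show "Q \<in> (\<lambda>b. shift_orbit (point b)) ` {b. set b \<subseteq> UNIV \<and> length b = n}"
        by (intro image_eqI[of _ _ "block p 0 n"]) auto
    qed
    have "(UNIV :: idx set) = {I0, I1}" using idx.exhaust by auto
    then have i: "finite (UNIV :: idx set)" by (metis finite.emptyI finite.insertI)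
    have "e \<in> Bm ` UNIV \<union> Bp ` UNIV \<union> {Em, Ep}" for e by (cases e) auto
    then have "(UNIV :: edge set) \<subseteq> Bm ` UNIV \<union> Bp ` UNIV \<union> {Em, Ep}" by blast
    then have "finite (UNIV :: edge set)" by (rule finite_subset) (use i in simp)
    then show "finite ((\<lambda>b. shift_orbit (point b)) ` {b :: edge list. set b \<subseteq> UNIV \<and> length b = n})"
      by (intro finite_imageI finite_lists_length_eq)
  qed
  show finM: "finite ?M" using sub fin by (rule finite_subset)
  have "2 * card ?M = card ?M + card (\<Phi> ` ?M)" using card_image[OF inj] by simp
  also have "\<dots> = card (?M \<union> \<Phi> ` ?M)" using im finM by (subst card_Un_disjoint) auto
  also have "\<dots> \<le> card (orbits_minus n)" using sub im fin by (intro card_mono) auto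
  finally show "2 * card ?M \<le> card (orbits_minus n)" .
qed

section \<open>Reversing time\<close>

fun gen_flip :: "gen \<Rightarrow> gen" where
  "gen_flip (Am n) = Ap n"
| "gen_flip (Ap n) = Am n"

text \<open>The anti-automorphism of \<open>\<D>\<^sub>2\<close> that exchanges \<open>\<alpha>\<^sub>-(n)\<close> and \<open>\<alpha>\<^sub>+(n)\<close>.\<close>

lift_definition dyck_rev :: "dyck \<Rightarrow> dyck" is "map_option (\<lambda>w. map gen_flip (rev w))"
proof -
  fix x y :: "gen list option"
  assume "dyck_cong x y"
  then show "dyck_cong (map_option (\<lambda>w. map gen_flip (rev w)) x) (map_option (\<lambda>w. map gen_flip (rev w)) y)"
  proof (induction rule: dyck_cong.induct)
    case (mult x x' y y')
    have "map_option (\<lambda>w. map gen_flip (rev w)) (raw_mult a b) =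
      raw_mult (map_option (\<lambda>w. map gen_flip (rev w)) b) (map_option (\<lambda>w. map gen_flip (rev w)) a)" for a b
      by (cases a; cases b) auto
    with dyck_cong.mult[OF mult.IH(2,1)] show ?case by simp
  qed (auto intro: dyck_cong.intros)
qed

lemma dyck_rev_mult: "dyck_rev (x * y) = dyck_rev y * dyck_rev x"
proof transfer
  fix a b :: "gen list option"
  show "dyck_cong (map_option (\<lambda>w. map gen_flip (rev w)) (raw_mult a b))
    (raw_mult (map_option (\<lambda>w. map gen_flip (rev w)) b) (map_option (\<lambda>w. map gen_flip (rev w)) a))"
    by (cases a; cases b) (auto intro: dyck_cong.refl)
qed

lemma dyck_rev_simps [simp]:
  "dyck_rev 0 = 0" "dyck_rev 1 = 1"
  "dyck_rev (alpha_minus n) = alpha_plus n" "dyck_rev (alpha_plus n) = alpha_minus n"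
  by (transfer; simp add: dyck_cong.refl)+

lemma dyck_rev_label: "dyck_rev (path_label b) = path_label (mirror b)"
proof (induction b)
  case (Cons e b)
  have "dyck_rev (edge_label e) = edge_label (flip e)" by (cases e) auto
  with Cons show ?case
    by (simp add: path_label_Cons dyck_rev_mult mirror_simps path_label_append)
      (simp add: path_label_def)
qed (simp add: path_label_def mirror_simps)

lemma dyck_rev_plus_word: "dyck_rev (prod_list (map alpha_plus (rev w)) ^ k) = minus_word w ^ k"
proof -
  have "dyck_rev (x ^ k) = dyck_rev x ^ k" for x
    by (induction k) (simp_all add: dyck_rev_mult power_commutes)
  moreover have "dyck_rev (prod_list (map alpha_plus (rev w))) = minus_word w"
    by (induction w) (simp_all add: dyck_rev_mult)
  ultimately show ?thesis by simp
qed

definition reversed :: "(int \<Rightarrow> edge) \<Rightarrow> int \<Rightarrow> edge" where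
  "reversed p i = flip (p (- i))"

lemma reversed_reversed [simp]: "reversed (reversed p) = p"
  by (simp add: reversed_def fun_eq_iff)

lemma mirror_mirror [simp]: "mirror (mirror b) = b"
  by (simp add: mirror_def rev_map comp_def)

lemma block_reversed: "block (reversed p) (1 - i - int n) n = mirror (block p i n)"
  by (rule nth_equalityI) (auto simp: mirror_def reversed_def rev_nth algebra_simps of_nat_diff)

lemma reversed_in_fib_dyck:
  assumes "p \<in> fib_dyck" shows "reversed p \<in> fib_dyck"
proof -
  have b: "block (reversed p) i n = mirror (block p (1 - i - int n) n)" for i n
    using block_reversed[of p "1 - i - int n" n] by simp
  have "tgt (reversed p i) = src (reversed p (i + 1))" for i
    using fib_dyck_step[OF assms, of "- i - 1"] by (simp add: reversed_def)
  then have "directed_path (block (reversed p) i n)" for i n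
    by (auto simp: directed_path_def successively_conv_nth algebra_simps)
  moreover have "path_label (block (reversed p) i n) \<noteq> 0" for i n
  proof
    assume "path_label (block (reversed p) i n) = 0"
    then have "dyck_rev (path_label (block (reversed p) i n)) = 0" by simp
    then have "path_label (block p (1 - i - int n) n) = 0" by (simp add: b dyck_rev_label)
    with assms show False by (simp add: fib_dyck_def)
  qed
  ultimately show ?thesis by (simp add: fib_dyck_def)
qed

lemma shift_reversed: "(shift ^^ n) (reversed p) = reversed p \<longleftrightarrow> (shift ^^ n) p = p"
proof -
  have *: "(shift ^^ n) (reversed q) = reversed q" if "(shift ^^ n) q = q" for q
  proof (rule ext)
    fix i
    have "q (- (i + int n) + int n) = q (- (i + int n))"
      using that by (simp only: shift_power fun_eq_iff)
    then show "(shift ^^ n) (reversed q) i = reversed q i"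
      by (simp add: shift_power reversed_def)
  qed
  from *[of p] *[of "reversed p"] show ?thesis by auto
qed

lemma shift_orbit_reversed: "shift_orbit (reversed p) = reversed ` shift_orbit p"
  unfolding shift_orbit_def
proof (intro equalityI subsetI; clarify)
  fix k
  show "(\<lambda>i. reversed p (i + k)) \<in> reversed ` range (\<lambda>k i. p (i + k))"
    by (rule image_eqI[of _ _ "\<lambda>i. p (i + (- k))"]) (simp add: reversed_def fun_eq_iff, rule rangeI)
  show "reversed (\<lambda>i. p (i + k)) \<in> range (\<lambda>k i. reversed p (i + k))"
    by (rule image_eqI[of _ _ "- k"]) (auto simp: reversed_def)
qed

lemma card_orbits_mult_plus_le:
  assumes "finite (orbits_mult_minus n \<mu>)"
  shows "card (orbits_mult_plus n \<mu>) \<le> card (orbits_mult_minus n \<mu>)"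
proof (rule card_inj_on_le[OF _ _ assms])
  have "inj reversed" by (metis injI reversed_reversed)
  then show "inj_on (image reversed) (orbits_mult_plus n \<mu>)"
    by (meson inj_image_eq_iff inj_onI)
  show "image reversed ` orbits_mult_plus n \<mu> \<subseteq> orbits_mult_minus n \<mu>"
  proof clarify
    fix Q assume "Q \<in> orbits_mult_plus n \<mu>"
    then obtain p where p: "p \<in> fib_dyck" "periodic p" "least_period p = n"
      "has_multiplier_plus \<mu> p" "Q = shift_orbit p"
      by (auto simp: orbits_mult_plus_def orbits_with_def)
    then obtain i w k where w: "w \<in> \<mu>" "k \<ge> 1"
      "path_label (block p i n) = prod_list (map alpha_plus (rev w)) ^ k"
      by (auto simp: has_multiplier_plus_def)
    have l: "periodic (reversed p)" "least_period (reversed p) = n"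
      using p(2,3) by (simp_all add: periodic_def least_period_def shift_reversed)
    have "path_label (block (reversed p) (1 - i - int n) n) = minus_word w ^ k"
      unfolding block_reversed dyck_rev_label[symmetric] w(3) dyck_rev_plus_word ..
    with w l have "has_multiplier_minus \<mu> (reversed p)"
      unfolding has_multiplier_minus_def by auto
    with l reversed_in_fib_dyck[OF p(1)] have "shift_orbit (reversed p) \<in> orbits_mult_minus n \<mu>"
      by (auto simp: orbits_mult_minus_def orbits_with_def)
    then show "reversed ` Q \<in> orbits_mult_minus n \<mu>" by (simp add: p(5) shift_orbit_reversed)
  qed
qed

section \<open>Representatives of a multiplier\<close>

lemma conjugate_iff_rotate: "conjugate b c \<longleftrightarrow> (\<exists>k. c = rotate k b)"
  unfolding conjugate_def
proof
  assume "\<exists>p q. b = p @ q \<and> c = q @ p"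
  then show "\<exists>k. c = rotate k b" by (metis rotate_append)
next
  assume "\<exists>k. c = rotate k b"
  then show "\<exists>p q. b = p @ q \<and> c = q @ p" by (metis append_take_drop_id rotate_drop_take)
qed

lemma conjugate_trans: "conjugate a b \<Longrightarrow> conjugate b c \<Longrightarrow> conjugate a c"
  by (auto simp: conjugate_iff_rotate rotate_rotate)

lemma constant_primitive:
  assumes "primitive w" "set w \<subseteq> {a}"
  shows "w = [a]"
proof -
  have "w = concat (replicate (length w) [a])" using assms(2) by (induction w) auto
  with assms(1) have "\<not> length w \<ge> 2" "w \<noteq> []" unfolding primitive_def by blast+
  with assms(2) show ?thesis by (cases w; cases "tl w") auto
qed

text \<open>Rotate first so that the word ends with \<open>I0\<close>, then move an initial run of \<open>I0\<close> to the end.\<close>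

lemma conjugate_normalise:
  assumes "I0 \<in> set w" "I1 \<in> set w"
  obtains w0 where "conjugate w (I1 # w0 @ [I0])"
proof -
  from assms(1) obtain a c where w: "w = a @ I0 # c" by (metis split_list)
  have 1: "conjugate w (c @ a @ [I0])" unfolding conjugate_def w by (intro exI[of _ "a @ [I0]"] exI[of _ c]) simp
  from assms(2) w have "I1 \<in> set (c @ a)" by auto
  then obtain b d where bd: "c @ a = b @ I1 # d" "I1 \<notin> set b" by (metis split_list_first)
  have "set b \<subseteq> {I0}" using bd(2) by (metis idx.exhaust singletonI subsetI)
  then have "\<exists>w0. d @ [I0] @ b = w0 @ [I0]"
    by (cases b rule: rev_cases) auto
  then obtain w0 where w0: "d @ [I0] @ b = w0 @ [I0]" by blast
  have "conjugate (c @ a @ [I0]) (I1 # d @ [I0] @ b)"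
    unfolding conjugate_def by (intro exI[of _ b] exI[of _ "I1 # d @ [I0]"]) (use bd(1) in \<open>simp flip: append_assoc\<close>)
  with conjugate_trans[OF 1] that w0 show thesis by metis
qed

theorem lemma2:
  fixes \<mu> :: "idx list set"
  assumes "\<mu> \<in> multipliers"
    and "\<mu> \<notin> {cyclic_class [I0], cyclic_class [I1]}"
  shows "\<not> exceptional \<mu>"
proof -
  from assms(1) obtain w where w: "primitive w" "\<mu> = cyclic_class w" by (auto simp: multipliers_def)
  have "I0 \<in> set w \<and> I1 \<in> set w"
  proof (rule ccontr)
    assume "\<not> ?thesis"
    then have "set w \<subseteq> {I1} \<or> set w \<subseteq> {I0}" by (metis idx.exhaust singletonI subsetI)
    with constant_primitive[OF w(1)] w(2) assms(2) show False by auto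
  qed
  then obtain w0 where w0: "conjugate w (I1 # w0 @ [I0])" using conjugate_normalise by blast
  have \<mu>: "conjugate v (I1 # w0 @ [I0])" if "v \<in> \<mu>" for v
  proof -
    have "conjugate w v" using that w(2) by (auto simp: cyclic_class_def conjugate_iff_rotate)
    with w0 show ?thesis by (blast intro: conjugate_sym conjugate_trans)
  qed
  have "\<not> exceptional_at \<mu> n" for n
  proof -
    note m = card_orbits_mult_minus[of \<mu> w0 n, OF \<mu>]
    have "card (orbits_mult_minus n \<mu> \<union> orbits_mult_plus n \<mu>)
        \<le> card (orbits_mult_minus n \<mu>) + card (orbits_mult_plus n \<mu>)" by (rule card_Un_le)
    also have "\<dots> \<le> card (orbits_minus n)"
      using card_orbits_mult_plus_le[OF m(2)] m(1) by linarith
    finally show ?thesis by (simp add: exceptional_at_def)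
  qed
  then show ?thesis by (simp add: exceptional_def)
qed

end
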